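(* Let $n\ge2$ and $\boldsymbol{\pi}\in\Delta_n^\circ$. (i) Writing $f(\cdot\mid\boldsymbol{\pi},\mathbf{x},\sigma)$ for the continuous density of $\mu_{\boldsymbol{\pi},\mathbf{x},\sigma}$ with respect to the Aitchison measure $\lambda_n$, we have $$\lim_{\sigma\downarrow0}\ \sup_{\mathbf{x},\mathbf{y}\in\Delta_n^\circ}\Big|-\sigma\log f(\mathbf{y}\mid\boldsymbol{\pi},\mathbf{x},\sigma)-\Gamma_{\boldsymbol{\pi}}(\mathbf{y}\,\|\,\mathbf{x})\Big|=0.$$ (ii) For every $\mathbf{x}\in\Delta_n^\circ$, the family $(\mu_{\boldsymbol{\pi},\mathbf{x},\sigma})_{\sigma>0}$ satisfies the large deviation principle on $\Delta_n^\circ$ with rate $1/\sigma$ and rate function $I(\mathbf{y})=\Gamma_{\boldsymbol{\pi}}(\mathbf{y}\,\|\,\mathbf{x})$; that is, for every closed $F\subseteq\Delta_n^\circ$ and open $G\subseteq\Delta_n^\circ$ (relative topology), $$\limsup_{\sigma\downarrow0}\sigma\log\mu_{\boldsymbol{\pi},\mathbf{x},\sigma}(F)\le-\inf_{\mathbf{y}\in F}\Gamma_{\boldsymbol{\pi}}(\mathbf{y}\,\|\,\mathbf{x}),\qquad \liminf_{\sigma\downarrow0}\sigma\log\mu_{\boldsymbol{\pi},\mathbf{x},\sigma}(G)\ge-\inf_{\mathbf{y}\in G}\Gamma_{\boldsymbol{\pi}}(\mathbf{y}\,\|\,\mathbf{x}).$$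
   Context: $\Delta_n^\circ=\{\mathbf{x}\in(0,1]^n:\sum_ix_i=1\}$. For $\mathbf{x}\in(0,\infty)^n$, $\mathcal{C}[\mathbf{x}]=\mathbf{x}/\sum_jx_j$ and $\mathbf{x}^{-1}=(1/x_i)_i$; $\odot$ is the componentwise product. For $\boldsymbol{\pi}\in\Delta_n^\circ$ and $\mathbf{x},\mathbf{y}\in(0,\infty)^n$, $\Gamma_{\boldsymbol{\pi}}(\mathbf{y}\,\|\,\mathbf{x})=\log\big(\sum_i\pi_i\frac{y_i}{x_i}\big)-\sum_i\pi_i\log\frac{y_i}{x_i}$. The scaled Dirichlet distribution $\mathcal{SD}(\boldsymbol{\alpha},\boldsymbol{\beta})$ ($\boldsymbol{\alpha},\boldsymbol{\beta}\in(0,\infty)^n$) is the law of $\mathcal{C}[\mathbf{X}]$ with $X_1,\dots,X_n$ independent, $X_i\sim\mathrm{Gamma}(\text{shape }\alpha_i,\text{ rate }\beta_i)$. For $\sigma>0$ and $\mathbf{x}\in\Delta_n^\circ$, $\mu_{\boldsymbol{\pi},\mathbf{x},\sigma}=\mathcal{SD}\big(\tfrac1\sigma\boldsymbol{\pi},\ \boldsymbol{\pi}\odot\mathbf{x}^{-1}\big)$. The Aitchison measure on $\Delta_n^\circ$ is $d\lambda_n(\mathbf{y})=\frac{1}{\sqrt n\prod_{i=1}^ny_i}dy_1\cdots dy_{n-1}$, where Lebesgue measure on $\{(y_1,\dots,y_{n-1})\in(0,1)^{n-1}:\sum y_i<1\}$ is transported to $\Delta_n^\circ$ via $(y_1,\dots,y_{n-1})\mapsto(y_1,\dots,y_{n-1},1-\sum_{i<n}y_i)$.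 *)

theory Defs
  imports "HOL-Probability.Probability"
begin

definition open_simplex :: "nat \<Rightarrow> (nat \<Rightarrow> real) set" where
  "open_simplex n = {x \<in> {..<n} \<rightarrow>\<^sub>E UNIV.
      (\<forall>i<n. 0 < x i \<and> x i \<le> 1) \<and> (\<Sum>i<n. x i) = 1}"

definition closure_op :: "nat \<Rightarrow> (nat \<Rightarrow> real) \<Rightarrow> (nat \<Rightarrow> real)" where
  "closure_op n x = (\<lambda>i\<in>{..<n}. x i / (\<Sum>j<n. x j))"

definition Gam :: "nat \<Rightarrow> (nat \<Rightarrow> real) \<Rightarrow> (nat \<Rightarrow> real) \<Rightarrow> (nat \<Rightarrow> real) \<Rightarrow> real" where
  "Gam n \<pi> y x = ln (\<Sum>i<n. \<pi> i * (y i / x i)) - (\<Sum>i<n. \<pi> i * ln (y i / x i))"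

definition gamma_density :: "real \<Rightarrow> real \<Rightarrow> real \<Rightarrow> real" where
  "gamma_density a b t = (if 0 < t then b powr a * t powr (a - 1) * exp (- b * t) / Gamma a else 0)"

definition scaled_dirichlet :: "nat \<Rightarrow> (nat \<Rightarrow> real) \<Rightarrow> (nat \<Rightarrow> real) \<Rightarrow> (nat \<Rightarrow> real) measure" where
  "scaled_dirichlet n \<alpha> \<beta> =
     distr (PiM {..<n} (\<lambda>i. density lborel (\<lambda>t. ennreal (gamma_density (\<alpha> i) (\<beta> i) t))))
           (PiM {..<n} (\<lambda>_. borel)) (closure_op n)"

definition mu :: "nat \<Rightarrow> (nat \<Rightarrow> real) \<Rightarrow> (nat \<Rightarrow> real) \<Rightarrow> real \<Rightarrow> (nat \<Rightarrow> real) measure" where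
  "mu n \<pi> x \<sigma> = scaled_dirichlet n (\<lambda>i. \<pi> i / \<sigma>) (\<lambda>i. \<pi> i / x i)"

text \<open>Aitchison measure: Lebesgue measure on the chart domain in R^(n-1), transported
  to the simplex by appending the last coordinate, with weight 1/(sqrt n * prod y_i).\<close>
definition chart_dom :: "nat \<Rightarrow> (nat \<Rightarrow> real) set" where
  "chart_dom n = {y \<in> {..<n-1} \<rightarrow>\<^sub>E UNIV.
      (\<forall>i<n-1. 0 < y i \<and> y i < 1) \<and> (\<Sum>i<n-1. y i) < 1}"

definition chart_embed :: "nat \<Rightarrow> (nat \<Rightarrow> real) \<Rightarrow> (nat \<Rightarrow> real)" where
  "chart_embed n y = (\<lambda>i\<in>{..<n}. if i < n - 1 then y i else 1 - (\<Sum>j<n-1. y j))"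

definition aitchison :: "nat \<Rightarrow> (nat \<Rightarrow> real) measure" where
  "aitchison n = density
     (distr (restrict_space (PiM {..<n-1} (\<lambda>_. lborel)) (chart_dom n))
            (PiM {..<n} (\<lambda>_. borel)) (chart_embed n))
     (\<lambda>y. ennreal (1 / (sqrt (real n) * (\<Prod>i<n. y i))))"

definition is_cont_density :: "nat \<Rightarrow> (nat \<Rightarrow> real) \<Rightarrow> (real \<Rightarrow> (nat \<Rightarrow> real) \<Rightarrow> (nat \<Rightarrow> real) \<Rightarrow> real) \<Rightarrow> bool" where
  "is_cont_density n \<pi> f \<longleftrightarrow>
     (\<forall>\<sigma>>0. \<forall>x\<in>open_simplex n.
        continuous_on (open_simplex n) (f \<sigma> x) \<and> (\<forall>y\<in>open_simplex n. 0 \<le> f \<sigma> x y) \<and>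
        mu n \<pi> x \<sigma> = density (aitchison n) (\<lambda>y. ennreal (f \<sigma> x y)))"

definition slog :: "real \<Rightarrow> real \<Rightarrow> ereal" where
  "slog \<sigma> p = (if p = 0 then - \<infinity> else ereal (\<sigma> * ln p))"

end

(* The scaled Dirichlet law is obtained by integrating the joint gamma density along rays: the map
   (y, s) to s * y splits into a translation of the last coordinate by the partial sum and a scaling
   of the remaining ones, so only affine substitutions are needed.  With the parameters of mu the
   resulting density is exactly c(sigma) * exp (- Gam / sigma), with a prefactor that depends on
   neither x nor y.  Both parts then reduce to sigma * ln c(sigma) tending to 0, which is Stirling's formula
   for ln_Gamma up to o(t).  The simplex is not compact and the Aitchison measure is infinite;
   the upper bound of (ii) therefore compares mu_sigma with the probability measure mu_1. *)
theory Submission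
  imports Defs "HOL-Real_Asymp.Real_Asymp"
begin

subsection \<open>Asymptotics of the log-Gamma function\<close>

text \<open>The statement of (i) concerns every continuous density, so an explicit formula helps
  only once continuous densities are known to be unique. That uniqueness, like the lower bound of
  (ii), rests on nonempty relatively open sets having positive Aitchison mass. Two coincidences make
  the formula free of error terms. The weight \<open>1 / (sqrt n * prod y_i)\<close> absorbs the
  \<open>-1\<close> in the gamma exponents, and because the weights \<open>\<pi> i\<close> sum to
  one, the shapes sum to \<open>1 / \<sigma>\<close>, which is exactly the power carried by the
  logarithm of the weighted mean in \<open>Gam\<close>. The supremum in (i) is therefore taken over
  a constant. A Stirling error of order o(t) suffices since the logarithm of the prefactor is
  multiplied by \<sigma>. The leading terms still contain \<open>p * ln \<sigma>\<close>, whose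
  coefficients cancel by the same normalisation of the weights.\<close>

lemma ln_Gamma_real_plus1:
  fixes t :: real
  assumes "t > 0"
  shows "ln_Gamma (t + 1) = ln_Gamma t + ln t"
proof -
  have "t \<notin> \<int>\<^sub>\<le>\<^sub>0"
    using assms nonpos_Ints_nonpos[of t] by auto
  then show ?thesis
    using assms by (simp add: ln_Gamma_real_pos Gamma_plus1 ln_mult_pos)
qed

text \<open>By the functional equation, \<open>ln t\<close> is the increment of
  \<open>ln_Gamma\<close> over \<open>[t, t + 1]\<close>. The mean value theorem makes it a value of
  \<open>Digamma\<close> inside that interval, and \<open>Digamma\<close> is increasing.\<close>

lemma Digamma_ln_bounds:
  fixes t :: real
  assumes "t > 0"
  shows "Digamma t \<le> ln t" and "ln t \<le> Digamma (t + 1)"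
proof -
  have "\<exists>z. t < z \<and> z < t + 1 \<and> ln_Gamma (t + 1) - ln_Gamma t = (t + 1 - t) * Digamma z"
    using assms by (intro MVT2) (auto intro!: derivative_eq_intros)
  then obtain z where z: "t < z" "z < t + 1" "ln t = Digamma z"
    using ln_Gamma_real_plus1[OF assms] by auto
  show "Digamma t \<le> ln t" "ln t \<le> Digamma (t + 1)"
    using z assms Digamma_real_mono[of t z] Digamma_real_mono[of z "t + 1"] by auto
qed

text \<open>L'Hospital's rule reduces the claim to \<open>Digamma t - ln t\<close> tending to 0. The
  bounds on \<open>Digamma\<close> squeeze this difference between \<open>ln ((t - 1) / t)\<close>
  and 0.\<close>

lemma ln_Gamma_weak_stirling:
  "((\<lambda>t::real. (ln_Gamma t - (t * ln t - t)) / t) \<longlongrightarrow> 0) at_top"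
proof (rule lhospital_at_top_at_top[where f' = "\<lambda>t. Digamma t - ln t" and g' = "\<lambda>_. 1"])
  show "\<forall>\<^sub>F t::real in at_top. ((\<lambda>t. ln_Gamma t - (t * ln t - t)) has_real_derivative
      Digamma t - ln t) (at t)"
    using eventually_gt_at_top[of 0]
    by eventually_elim (auto intro!: derivative_eq_intros)
  have "((\<lambda>t::real. ln ((t - 1) / t)) \<longlongrightarrow> ln 1) at_top"
    by (intro tendsto_ln) (auto, real_asymp)
  then have lim: "((\<lambda>t::real. ln ((t - 1) / t)) \<longlongrightarrow> 0) at_top"
    by simp
  show "((\<lambda>t::real. (Digamma t - ln t) / 1) \<longlongrightarrow> 0) at_top"
  proof (rule tendsto_sandwich[OF _ _ lim])
    show "\<forall>\<^sub>F t::real in at_top. ln ((t - 1) / t) \<le> (Digamma t - ln t) / 1"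
      using eventually_gt_at_top[of 1]
    proof eventually_elim
      case (elim t)
      then show ?case using Digamma_ln_bounds(2)[of "t - 1"] by (simp add: ln_div)
    qed
    show "\<forall>\<^sub>F t::real in at_top. (Digamma t - ln t) / 1 \<le> 0"
      using eventually_gt_at_top[of 0]
      by eventually_elim (auto simp: Digamma_ln_bounds)
  qed (rule tendsto_const)
qed (auto simp: filterlim_ident)

text \<open>The logarithm of the prefactor c(sigma) of \<open>exp (- Gam / \<sigma>)\<close> in the density.\<close>
definition log_const :: "nat \<Rightarrow> (nat \<Rightarrow> real) \<Rightarrow> real \<Rightarrow> real" where
  "log_const n \<pi> \<sigma> = ln (sqrt n) + ln_Gamma (1 / \<sigma>) - (\<Sum>i<n. ln_Gamma (\<pi> i / \<sigma>))
     + (\<Sum>i<n. \<pi> i * ln (\<pi> i)) / \<sigma>"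

text \<open>This is the weak Stirling formula at \<open>t = p / \<sigma>\<close>, multiplied by
  \<sigma>. The term \<open>p * ln \<sigma>\<close> has to stay inside, since it is linear in
  \<open>p\<close> and disappears only when several values of \<open>p\<close> are combined.\<close>

lemma ln_Gamma_scaled_limit:
  fixes p :: real
  assumes "p > 0"
  shows "((\<lambda>\<sigma>. \<sigma> * ln_Gamma (p / \<sigma>) - (p * ln p - p * ln \<sigma> - p)) \<longlongrightarrow> 0) (at_right 0)"
proof -
  have "filterlim (\<lambda>\<sigma>. p / \<sigma>) at_top (at_right 0)"
    using filterlim_tendsto_pos_mult_at_top[OF tendsto_const[of p] assms filterlim_inverse_at_top_right]
    by (simp add: divide_inverse)
  from filterlim_compose[OF ln_Gamma_weak_stirling this]
  have "((\<lambda>\<sigma>. p * ((ln_Gamma (p / \<sigma>) - (p / \<sigma> * ln (p / \<sigma>) - p / \<sigma>)) / (p / \<sigma>))) \<longlongrightarrow> p * 0) (at_right 0)"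
    by (rule tendsto_mult_left)
  then have "((\<lambda>\<sigma>. p * ((ln_Gamma (p / \<sigma>) - (p / \<sigma> * ln (p / \<sigma>) - p / \<sigma>)) / (p / \<sigma>))) \<longlongrightarrow> 0) (at_right 0)"
    by simp
  then show ?thesis
  proof (rule Lim_transform_eventually)
    show "\<forall>\<^sub>F \<sigma> in at_right 0. p * ((ln_Gamma (p / \<sigma>) - (p / \<sigma> * ln (p / \<sigma>) - p / \<sigma>)) / (p / \<sigma>)) =
        \<sigma> * ln_Gamma (p / \<sigma>) - (p * ln p - p * ln \<sigma> - p)"
      using eventually_at_right_less[of 0]
      by eventually_elim (use assms in \<open>simp add: ln_div field_simps\<close>)
  qed
qed

text \<open>The remainder for \<open>p = 1\<close> minus the remainders for the
  \<open>\<pi> i\<close> loses its \<open>ln \<sigma>\<close> and linear terms because the weights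
  sum to one. What is left over, the sum of \<open>\<pi> i * ln (\<pi> i)\<close>, is the last term
  of \<open>log_const\<close>.\<close>

lemma log_const_limit:
  assumes pos: "\<And>i. i < n \<Longrightarrow> \<pi> i > 0" and sum1: "(\<Sum>i<n. \<pi> i) = 1"
  shows "((\<lambda>\<sigma>. \<sigma> * log_const n \<pi> \<sigma>) \<longlongrightarrow> 0) (at_right 0)"
proof -
  let ?R = "\<lambda>p \<sigma>. \<sigma> * ln_Gamma (p / \<sigma>) - (p * ln p - p * ln \<sigma> - p)"
  have "((\<lambda>\<sigma>. \<sigma> * ln (sqrt n) + ?R 1 \<sigma> - (\<Sum>i<n. ?R (\<pi> i) \<sigma>)) \<longlongrightarrow> 0 * ln (sqrt n) + 0 - (\<Sum>i<n. 0)) (at_right 0)"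
    by (intro tendsto_intros ln_Gamma_scaled_limit) (use pos in auto)
  then have "((\<lambda>\<sigma>. \<sigma> * ln (sqrt n) + ?R 1 \<sigma> - (\<Sum>i<n. ?R (\<pi> i) \<sigma>)) \<longlongrightarrow> 0) (at_right 0)"
    by simp
  then show ?thesis
  proof (rule Lim_transform_eventually)
    show "\<forall>\<^sub>F \<sigma> in at_right 0. \<sigma> * ln (sqrt n) + ?R 1 \<sigma> - (\<Sum>i<n. ?R (\<pi> i) \<sigma>) = \<sigma> * log_const n \<pi> \<sigma>"
      using eventually_at_right_less[of 0]
    proof eventually_elim
      case (elim \<sigma>)
      have "(\<Sum>i<n. ?R (\<pi> i) \<sigma>) = (\<Sum>i<n. \<sigma> * ln_Gamma (\<pi> i / \<sigma>)) - (\<Sum>i<n. \<pi> i * ln (\<pi> i)) + ln \<sigma> * (\<Sum>i<n. \<pi> i) + (\<Sum>i<n. \<pi> i)"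
        by (simp add: sum_subtractf sum.distrib sum_distrib_left algebra_simps)
      moreover have "\<sigma> * log_const n \<pi> \<sigma> = \<sigma> * ln (sqrt n) + \<sigma> * ln_Gamma (1 / \<sigma>)
          - (\<Sum>i<n. \<sigma> * ln_Gamma (\<pi> i / \<sigma>)) + (\<Sum>i<n. \<pi> i * ln (\<pi> i))"
        unfolding log_const_def ring_distribs sum_distrib_left[symmetric] using elim by simp
      ultimately show ?case by (simp add: sum1)
    qed
  qed
qed

subsection \<open>Product Lebesgue measure in ray coordinates\<close>

interpretation lborel_PiM: product_sigma_finite "\<lambda>_::nat. lborel :: real measure" ..

lemma emeasure_lborel_scale:
  fixes s :: real
  assumes "s > 0" and [measurable]: "A \<in> sets borel"
  shows "emeasure lborel A = ennreal s * emeasure lborel {x. s * x \<in> A}"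
proof -
  have "emeasure lborel A = (\<integral>\<^sup>+x. indicator A x \<partial>lborel)"
    by simp
  also have "\<dots> = ennreal s * (\<integral>\<^sup>+x. indicator A (0 + s * x) \<partial>lborel)"
    using assms by (subst nn_integral_real_affine[where c = s and t = 0]) auto
  also have "(\<integral>\<^sup>+x. indicator A (0 + s * x) \<partial>lborel) = (\<integral>\<^sup>+x. indicator {x. s * x \<in> A} x \<partial>lborel)"
    by (intro nn_integral_cong) (auto simp: indicator_def)
  also have "\<dots> = emeasure lborel {x. s * x \<in> A}"
    by (rule nn_integral_indicator) simp
  finally show ?thesis .
qed

text \<open>Formulated as an equality of measures, the substitution rule needs checking on boxes
  only, where each coordinate contributes one factor \<open>s\<close>. General integrands then
  follow at once.\<close>

lemma PiM_lborel_scale: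
  fixes s :: real and I :: "nat set"
  assumes s: "s > 0" and [simp]: "finite I"
  shows "density (distr (PiM I (\<lambda>_. lborel)) (PiM I (\<lambda>_. lborel)) (\<lambda>y. \<lambda>i\<in>I. s * y i))
      (\<lambda>_. ennreal (s ^ card I)) = PiM I (\<lambda>_. lborel)"
proof (rule lborel_PiM.PiM_eqI)
  fix A :: "nat \<Rightarrow> real set"
  assume A: "\<And>i. i \<in> I \<Longrightarrow> A i \<in> sets lborel"
  have [measurable]: "Pi\<^sub>E I A \<in> sets (PiM I (\<lambda>_. lborel))"
    using A by (intro sets_PiM_I_finite) auto
  have "emeasure (density (distr (PiM I (\<lambda>_. lborel)) (PiM I (\<lambda>_. lborel)) (\<lambda>y. \<lambda>i\<in>I. s * y i))
      (\<lambda>_. ennreal (s ^ card I))) (Pi\<^sub>E I A)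
      = ennreal (s ^ card I) * emeasure (distr (PiM I (\<lambda>_. lborel)) (PiM I (\<lambda>_. lborel)) (\<lambda>y. \<lambda>i\<in>I. s * y i)) (Pi\<^sub>E I A)"
    by (subst emeasure_density_const) auto
  also have "emeasure (distr (PiM I (\<lambda>_. lborel)) (PiM I (\<lambda>_. lborel)) (\<lambda>y. \<lambda>i\<in>I. s * y i)) (Pi\<^sub>E I A)
      = emeasure (PiM I (\<lambda>_. lborel)) (Pi\<^sub>E I (\<lambda>i. {x. s * x \<in> A i}))"
    by (subst emeasure_distr) (auto intro!: arg_cong[where f = "emeasure _"] simp: space_PiM PiE_iff)
  also have "\<dots> = (\<Prod>i\<in>I. emeasure lborel {x. s * x \<in> A i})"
    using A by (intro lborel_PiM.emeasure_PiM) (auto intro: borel_measurable_vimage)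
  also have "ennreal (s ^ card I) * \<dots> = (\<Prod>i\<in>I. ennreal s * emeasure lborel {x. s * x \<in> A i})"
    using s by (simp add: prod.distrib ennreal_power)
  also have "\<dots> = (\<Prod>i\<in>I. emeasure lborel (A i))"
    using A s by (intro prod.cong refl emeasure_lborel_scale[symmetric]) auto
  finally show "emeasure (density (distr (PiM I (\<lambda>_. lborel)) (PiM I (\<lambda>_. lborel)) (\<lambda>y. \<lambda>i\<in>I. s * y i))
      (\<lambda>_. ennreal (s ^ card I))) (Pi\<^sub>E I A) = (\<Prod>i\<in>I. emeasure lborel (A i))" .
qed auto

lemma nn_integral_PiM_lborel_scale:
  fixes s :: real and I :: "nat set"
  assumes s: "s > 0" and [simp]: "finite I"
    and [measurable]: "h \<in> borel_measurable (PiM I (\<lambda>_. lborel))"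
  shows "(\<integral>\<^sup>+x. h x \<partial>PiM I (\<lambda>_. lborel))
      = (\<integral>\<^sup>+y. ennreal (s ^ card I) * h (\<lambda>i\<in>I. s * y i) \<partial>PiM I (\<lambda>_. lborel))"
  by (subst PiM_lborel_scale[OF s, symmetric]) (simp_all add: nn_integral_density nn_integral_distr)

section \<open>Integration over the orthant along rays through the simplex\<close>

definition positive_orthant :: "nat \<Rightarrow> (nat \<Rightarrow> real) set" where
  "positive_orthant n = {x \<in> {..<n} \<rightarrow>\<^sub>E UNIV. \<forall>i<n. 0 < x i}"

lemma positive_orthant_measurable [measurable]:
  "positive_orthant n \<in> sets (PiM {..<n} (\<lambda>_. borel))"
proof -
  have "positive_orthant n = {x \<in> space (PiM {..<n} (\<lambda>_. borel)). \<forall>i\<in>{..<n}. 0 < x i}"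
    by (auto simp: positive_orthant_def space_PiM)
  also have "\<dots> \<in> sets (PiM {..<n} (\<lambda>_. borel))"
    by measurable
  finally show ?thesis .
qed

lemma chart_dom_measurable [measurable]:
  "chart_dom n \<in> sets (PiM {..<n - 1} (\<lambda>_. borel))"
proof -
  have "chart_dom n = {y \<in> space (PiM {..<n - 1} (\<lambda>_. borel)).
      (\<forall>i\<in>{..<n - 1}. 0 < y i \<and> y i < 1) \<and> (\<Sum>i<n - 1. y i) < 1}"
    by (auto simp: chart_dom_def space_PiM)
  also have "\<dots> \<in> sets (PiM {..<n - 1} (\<lambda>_. borel))"
    by measurable
  finally show ?thesis .
qed

lemma chart_embed_measurable [measurable]:
  "chart_embed n \<in> measurable (PiM {..<n - 1} (\<lambda>_. borel)) (PiM {..<n} (\<lambda>_. borel))"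
  unfolding chart_embed_def
proof (rule measurable_restrict)
  fix i assume "i \<in> {..<n}"
  show "(\<lambda>y. if i < n - 1 then y i else 1 - (\<Sum>j<n - 1. y j :: real)) \<in> borel_measurable (PiM {..<n - 1} (\<lambda>_. borel))"
    by (cases "i < n - 1") auto
qed

lemma chart_measurable_lborel [measurable]:
  "chart_embed n \<in> measurable (PiM {..<n - 1} (\<lambda>_. lborel)) (PiM {..<n} (\<lambda>_. borel))"
  "chart_dom n \<in> sets (PiM {..<n - 1} (\<lambda>_. lborel))"
proof -
  have sets_P: "sets (PiM {..<n - 1} (\<lambda>_. lborel :: real measure)) = sets (PiM {..<n - 1} (\<lambda>_. borel))"
    by (rule sets_PiM_cong) auto
  show "chart_embed n \<in> measurable (PiM {..<n - 1} (\<lambda>_. lborel)) (PiM {..<n} (\<lambda>_. borel))"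
    "chart_dom n \<in> sets (PiM {..<n - 1} (\<lambda>_. lborel))"
    using chart_embed_measurable[of n] chart_dom_measurable[of n]
    by (simp_all only: sets_P measurable_cong_sets[OF sets_P refl])
qed

text \<open>The translation is carried out for fixed \<open>x\<close> and the scaling for fixed
  \<open>s\<close>, so the order of integration is exchanged between the two and restored at the
  end. The power \<open>s ^ (n - 1)\<close> is the Jacobian of the scaling.\<close>

lemma nn_integral_polar:
  fixes H :: "(nat \<Rightarrow> real) \<Rightarrow> ennreal"
  assumes n: "n \<ge> 2" and [measurable]: "H \<in> borel_measurable (PiM {..<n} (\<lambda>_. borel))"
  shows "(\<integral>\<^sup>+x. H x * indicator (positive_orthant n) x \<partial>PiM {..<n} (\<lambda>_. lborel))
    = (\<integral>\<^sup>+y. (\<integral>\<^sup>+s. ennreal (s ^ (n - 1)) * H (\<lambda>i\<in>{..<n}. s * chart_embed n y i) * indicator {0<..} s \<partial>lborel)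
        * indicator (chart_dom n) y \<partial>PiM {..<n - 1} (\<lambda>_. lborel))"
proof -
  define m where "m = n - 1"
  have n_eq: "n = Suc m" "m \<ge> 1" using n by (auto simp: m_def)
  let ?P = "PiM {..<m} (\<lambda>_. lborel :: real measure)"
  define K where "K x = H x * indicator (positive_orthant n) x" for x
  \<comment> \<open>\<open>J x s\<close> is the point whose first \<open>m\<close> coordinates are
    those of \<open>x\<close> and whose coordinates add up to \<open>s\<close>.\<close>
  define J where "J x s = (\<lambda>i\<in>{..<n}. if i < m then x i else s - (\<Sum>j<m. x j))"
    for x :: "nat \<Rightarrow> real" and s :: real
  interpret P: finite_product_sigma_finite "\<lambda>_. lborel :: real measure" "{..<m}" by standard simp
  interpret PL: pair_sigma_finite ?P "lborel :: real measure"
    by (intro pair_sigma_finite.intro P.sigma_finite_measure_axioms lborel.sigma_finite_measure_axioms)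
  have K[measurable]: "K \<in> borel_measurable (PiM {..<n} (\<lambda>_. borel))"
    unfolding K_def by measurable
  have [measurable]: "chart_embed n \<in> measurable ?P (PiM {..<n} (\<lambda>_. borel))" "chart_dom n \<in> sets ?P"
    using chart_measurable_lborel[of n] by (simp_all only: m_def)
  have J[measurable]: "(\<lambda>p. J (fst p) (snd p)) \<in> measurable (?P \<Otimes>\<^sub>M lborel) (PiM {..<n} (\<lambda>_. borel))"
    unfolding J_def
  proof (rule measurable_restrict)
    fix i
    show "(\<lambda>p. if i < m then fst p i else snd p - (\<Sum>j<m. fst p j)) \<in> borel_measurable (?P \<Otimes>\<^sub>M lborel)"
      by (cases "i < m") auto
  qed
  have "(\<integral>\<^sup>+x. K x \<partial>PiM {..<n} (\<lambda>_. lborel)) = (\<integral>\<^sup>+x. \<integral>\<^sup>+t. K (x(m := t)) \<partial>lborel \<partial>?P)"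
    unfolding n_eq lessThan_Suc by (rule lborel_PiM.product_nn_integral_insert) (use K in \<open>auto simp: n_eq lessThan_Suc\<close>)
  also have "\<dots> = (\<integral>\<^sup>+x. \<integral>\<^sup>+s. K (J x s) \<partial>lborel \<partial>?P)"
  proof (rule nn_integral_cong)
    fix x assume x: "x \<in> space ?P"
    have eq: "x(m := t) = J x (t + (\<Sum>j<m. x j))" for t
      using x by (auto simp: J_def n_eq space_PiM PiE_iff extensional_def)
    have "(\<integral>\<^sup>+s. K (J x s) \<partial>lborel) = ennreal \<bar>1\<bar> * (\<integral>\<^sup>+t. K (J x ((\<Sum>j<m. x j) + 1 * t)) \<partial>lborel)"
      using measurable_compose[OF measurable_Pair1'[OF x] J]
      by (intro nn_integral_real_affine) auto
    then show "(\<integral>\<^sup>+t. K (x(m := t)) \<partial>lborel) = (\<integral>\<^sup>+s. K (J x s) \<partial>lborel)"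
      by (simp add: eq add.commute)
  qed
  \<comment> \<open>The scaling factor will be the total \<open>s\<close>, so \<open>s\<close> must
    be fixed before the inner coordinates are substituted.\<close>
  also have "\<dots> = (\<integral>\<^sup>+s. \<integral>\<^sup>+x. K (J x s) \<partial>?P \<partial>lborel)"
    by (intro PL.Fubini'[symmetric]) (simp add: split_beta')
  also have "\<dots> = (\<integral>\<^sup>+s. \<integral>\<^sup>+y. ennreal (s ^ m) * H (\<lambda>i\<in>{..<n}. s * chart_embed n y i)
      * indicator {0<..} s * indicator (chart_dom n) y \<partial>?P \<partial>lborel)"
  proof (rule nn_integral_cong)
    fix s :: real
    show "(\<integral>\<^sup>+x. K (J x s) \<partial>?P) = (\<integral>\<^sup>+y. ennreal (s ^ m) * H (\<lambda>i\<in>{..<n}. s * chart_embed n y i)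
        * indicator {0<..} s * indicator (chart_dom n) y \<partial>?P)"
    proof (cases "s > 0")
      case False
      \<comment> \<open>A point with positive coordinates has a positive total, so nonpositive
        \<open>s\<close> contributes nothing on either side.\<close>
      have "J x s \<notin> positive_orthant n" for x
      proof
        assume "J x s \<in> positive_orthant n"
        then have pos: "\<And>i. i < n \<Longrightarrow> 0 < J x s i" by (auto simp: positive_orthant_def)
        have x_pos: "0 < x i" if "i < m" for i
          using pos[of i] that by (simp add: J_def n_eq)
        moreover have "0 < s - (\<Sum>j<m. x j)"
          using pos[of m] by (simp add: J_def n_eq)
        moreover have "(\<Sum>j<m. x j) \<ge> 0" using x_pos by (intro sum_nonneg) (auto intro: less_imp_le)
        ultimately show False using False by simp
      qed
      then show ?thesis using False by (simp add: K_def)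
    next
      case True
      \<comment> \<open>After \<open>x = s * y\<close> the last coordinate \<open>s - sum x\<close>
        becomes \<open>s * (1 - sum y)\<close>, which is \<open>s\<close> times the coordinate
        appended by the chart.\<close>
      have Js: "J (\<lambda>i\<in>{..<m}. s * y i) s = (\<lambda>i\<in>{..<n}. s * chart_embed n y i)" for y
        by (auto simp: J_def chart_embed_def n_eq fun_eq_iff sum_distrib_left[symmetric] algebra_simps)
      have dom: "(\<lambda>i\<in>{..<n}. s * chart_embed n y i) \<in> positive_orthant n \<longleftrightarrow> y \<in> chart_dom n"
        if y: "y \<in> space ?P" for y
      proof -
        have "(\<lambda>i\<in>{..<n}. s * chart_embed n y i) \<in> positive_orthant n
          \<longleftrightarrow> (\<forall>i<n. 0 < chart_embed n y i)"
          using True by (auto simp: positive_orthant_def zero_less_mult_iff)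
        also have "\<dots> \<longleftrightarrow> (\<forall>i<m. 0 < y i) \<and> (\<Sum>j<m. y j) < 1"
          by (auto simp: chart_embed_def n_eq less_Suc_eq)
        also have "\<dots> \<longleftrightarrow> y \<in> chart_dom n"
        proof -
          have "y i < 1" if "\<forall>i<m. 0 < y i" "(\<Sum>j<m. y j) < 1" "i < m" for i
          proof -
            have "y i \<le> (\<Sum>j<m. y j)"
              using that by (intro member_le_sum) (auto intro: less_imp_le)
            then show ?thesis using that by simp
          qed
          then show ?thesis using y by (auto simp: chart_dom_def n_eq space_PiM)
        qed
        finally show ?thesis .
      qed
      have "(\<integral>\<^sup>+x. K (J x s) \<partial>?P) = (\<integral>\<^sup>+y. ennreal (s ^ m) * K (J (\<lambda>i\<in>{..<m}. s * y i) s) \<partial>?P)"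
        using measurable_compose[OF measurable_Pair2' J, of s]
        by (subst nn_integral_PiM_lborel_scale[OF True]) auto
      also have "\<dots> = (\<integral>\<^sup>+y. ennreal (s ^ m) * H (\<lambda>i\<in>{..<n}. s * chart_embed n y i)
        * indicator {0<..} s * indicator (chart_dom n) y \<partial>?P)"
        using True dom by (intro nn_integral_cong) (auto simp: Js K_def indicator_def)
      finally show ?thesis .
    qed
  qed
  also have "\<dots> = (\<integral>\<^sup>+y. \<integral>\<^sup>+s. ennreal (s ^ m) * H (\<lambda>i\<in>{..<n}. s * chart_embed n y i)
      * indicator {0<..} s * indicator (chart_dom n) y \<partial>lborel \<partial>?P)"
    by (intro PL.Fubini') (simp add: split_beta')
  also have "\<dots> = (\<integral>\<^sup>+y. (\<integral>\<^sup>+s. ennreal (s ^ m) * H (\<lambda>i\<in>{..<n}. s * chart_embed n y i)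
      * indicator {0<..} s \<partial>lborel) * indicator (chart_dom n) y \<partial>?P)"
    by (intro nn_integral_cong nn_integral_multc) simp
  finally show ?thesis unfolding K_def m_def .
qed

subsection \<open>The scaled Dirichlet density\<close>

lemma nn_integral_gamma:
  fixes a b :: real
  assumes a: "a > 0" and b: "b > 0"
  shows "(\<integral>\<^sup>+t. ennreal (t powr (a - 1) * exp (- b * t)) * indicator {0<..} t \<partial>lborel)
    = ennreal (Gamma a / b powr a)"
proof -
  have "ennreal (Gamma a) = (\<integral>\<^sup>+t. ennreal (indicator {0..} t * t powr (a - 1) / exp t) \<partial>lborel)"
    using a by (rule Gamma_conv_nn_integral_real)
  also have "\<dots> = ennreal \<bar>b\<bar> * (\<integral>\<^sup>+t. ennreal (indicator {0..} (0 + b * t) * (0 + b * t) powr (a - 1) / exp (0 + b * t)) \<partial>lborel)"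
    using b by (intro nn_integral_real_affine) auto
  also have "(\<integral>\<^sup>+t. ennreal (indicator {0..} (0 + b * t) * (0 + b * t) powr (a - 1) / exp (0 + b * t)) \<partial>lborel)
    = (\<integral>\<^sup>+t. ennreal (b powr (a - 1)) * (ennreal (t powr (a - 1) * exp (- b * t)) * indicator {0<..} t) \<partial>lborel)"
  proof (rule nn_integral_cong)
    fix t :: real
    \<comment> \<open>At \<open>t = 0\<close> the integrands agree although one indicator includes 0
      and the other does not: \<open>0 powr z\<close> is 0 for every \<open>z\<close>.\<close>
    consider "t > 0" | "t = 0" | "t < 0" by linarith
    then show "ennreal (indicator {0..} (0 + b * t) * (0 + b * t) powr (a - 1) / exp (0 + b * t))
      = ennreal (b powr (a - 1)) * (ennreal (t powr (a - 1) * exp (- b * t)) * indicator {0<..} t)"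
      by cases (use b in \<open>auto simp: powr_mult exp_minus field_simps mult_less_0_iff zero_le_mult_iff
        simp flip: ennreal_mult'\<close>)
  qed
  also have "\<dots> = ennreal (b powr (a - 1)) * (\<integral>\<^sup>+t. ennreal (t powr (a - 1) * exp (- b * t)) * indicator {0<..} t \<partial>lborel)"
    by (rule nn_integral_cmult) simp
  also have "ennreal \<bar>b\<bar> * \<dots> = ennreal (b powr a) * (\<integral>\<^sup>+t. ennreal (t powr (a - 1) * exp (- b * t)) * indicator {0<..} t \<partial>lborel)"
    using b by (simp add: powr_diff mult.assoc[symmetric] flip: ennreal_mult')
  \<comment> \<open>Multiplying by the reciprocal of \<open>b powr a\<close> takes the place of a
    division in \<open>ennreal\<close>.\<close>
  finally have "ennreal (1 / b powr a) * ennreal (Gamma a)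
    = (ennreal (1 / b powr a) * ennreal (b powr a)) * (\<integral>\<^sup>+t. ennreal (t powr (a - 1) * exp (- b * t)) * indicator {0<..} t \<partial>lborel)"
    by (simp add: mult.assoc)
  also have "ennreal (1 / b powr a) * ennreal (b powr a) = 1"
    using b by (simp flip: ennreal_mult')
  finally show ?thesis
    by (simp flip: ennreal_mult')
qed

lemma gamma_density_measurable [measurable]: "gamma_density a b \<in> borel_measurable borel"
  unfolding gamma_density_def by measurable

lemma gamma_density_nonneg: "a > 0 \<Longrightarrow> 0 \<le> gamma_density a b t"
  by (auto simp: gamma_density_def Gamma_real_pos less_imp_le)

lemma prob_space_gamma:
  assumes a: "a > 0" and b: "b > 0"
  shows "prob_space (density lborel (\<lambda>t. ennreal (gamma_density a b t)))"
proof
  have "emeasure (density lborel (\<lambda>t. ennreal (gamma_density a b t))) UNIV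
    = (\<integral>\<^sup>+t. ennreal (gamma_density a b t) \<partial>lborel)"
    by (subst emeasure_density) auto
  also have "\<dots> = (\<integral>\<^sup>+t. ennreal (b powr a / Gamma a) *
      (ennreal (t powr (a - 1) * exp (- b * t)) * indicator {0<..} t) \<partial>lborel)"
    using Gamma_real_pos[OF a]
    by (intro nn_integral_cong) (auto simp: gamma_density_def indicator_def simp flip: ennreal_mult')
  also have "\<dots> = ennreal (b powr a / Gamma a) * ennreal (Gamma a / b powr a)"
    by (subst nn_integral_cmult) (auto simp only: nn_integral_gamma[OF a b], measurable)
  also have "\<dots> = 1"
    using Gamma_real_pos[OF a] b by (subst ennreal_mult'[symmetric]) auto
  finally show "emeasure (density lborel (\<lambda>t. ennreal (gamma_density a b t)))
      (space (density lborel (\<lambda>t. ennreal (gamma_density a b t)))) = 1"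
    by simp
qed

text \<open>On a box both the product density and the indicator split into one factor per
  coordinate, so the integral becomes a product of one-dimensional integrals. Agreement on boxes
  determines the product measure.\<close>

lemma PiM_density_lborel:
  fixes I :: "nat set" and g :: "nat \<Rightarrow> real \<Rightarrow> ennreal"
  assumes I [simp]: "finite I"
    and g [measurable]: "\<And>i. i \<in> I \<Longrightarrow> g i \<in> borel_measurable borel"
    and sf: "\<And>i. i \<in> I \<Longrightarrow> sigma_finite_measure (density lborel (g i))"
  shows "PiM I (\<lambda>i. density lborel (g i)) = density (PiM I (\<lambda>_. lborel)) (\<lambda>x. \<Prod>i\<in>I. g i (x i))"
proof -
  \<comment> \<open>The product locale asks for sigma-finiteness at every index, whereas
    \<open>g\<close> is controlled only on \<open>I\<close>; outside \<open>I\<close> the family is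
    filled up with \<open>lborel\<close>.\<close>
  define M where "M i = (if i \<in> I then density lborel (g i) else lborel)" for i
  interpret product_sigma_finite M
    using sf by (auto simp: product_sigma_finite_def M_def lborel.sigma_finite_measure_axioms)
  have sets_M: "sets (M i) = sets lborel" for i
    by (simp add: M_def)
  have "density (PiM I (\<lambda>_. lborel)) (\<lambda>x. \<Prod>i\<in>I. g i (x i)) = PiM I M"
  proof (rule PiM_eqI)
    show "sets (density (PiM I (\<lambda>_. lborel)) (\<lambda>x. \<Prod>i\<in>I. g i (x i))) = sets (PiM I M)"
      by (simp add: sets_M cong: sets_PiM_cong)
    fix A assume "\<And>i. i \<in> I \<Longrightarrow> A i \<in> sets (M i)"
    then have A [measurable]: "\<And>i. i \<in> I \<Longrightarrow> A i \<in> sets borel"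
      by (simp add: sets_M)
    have [measurable]: "Pi\<^sub>E I A \<in> sets (PiM I (\<lambda>_. lborel))"
      using A by (intro sets_PiM_I_finite) auto
    have "emeasure (density (PiM I (\<lambda>_. lborel)) (\<lambda>x. \<Prod>i\<in>I. g i (x i))) (Pi\<^sub>E I A)
      = (\<integral>\<^sup>+x. (\<Prod>i\<in>I. g i (x i)) * indicator (Pi\<^sub>E I A) x \<partial>PiM I (\<lambda>_. lborel))"
      by (subst emeasure_density) auto
    also have "\<dots> = (\<integral>\<^sup>+x. (\<Prod>i\<in>I. g i (x i) * indicator (A i) (x i)) \<partial>PiM I (\<lambda>_. lborel))"
    proof (rule nn_integral_cong)
      fix x :: "nat \<Rightarrow> real" assume x: "x \<in> space (PiM I (\<lambda>_. lborel))"
      show "(\<Prod>i\<in>I. g i (x i)) * indicator (Pi\<^sub>E I A) x = (\<Prod>i\<in>I. g i (x i) * indicator (A i) (x i))"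
      proof (cases "x \<in> Pi\<^sub>E I A")
        case True
        then show ?thesis by (auto simp: PiE_iff intro!: prod.cong)
      next
        case False
        then obtain i where "i \<in> I" "x i \<notin> A i"
          using x by (auto simp: PiE_iff space_PiM)
        then show ?thesis using False by (auto intro!: prod_zero[symmetric] bexI[of _ i])
      qed
    qed
    also have "\<dots> = (\<Prod>i\<in>I. \<integral>\<^sup>+t. g i t * indicator (A i) t \<partial>lborel)"
      by (rule lborel_PiM.product_nn_integral_prod) auto
    also have "\<dots> = (\<Prod>i\<in>I. emeasure (M i) (A i))"
      by (intro prod.cong refl) (simp add: M_def emeasure_density)
    finally show "emeasure (density (PiM I (\<lambda>_. lborel)) (\<lambda>x. \<Prod>i\<in>I. g i (x i))) (Pi\<^sub>E I A)
      = (\<Prod>i\<in>I. emeasure (M i) (A i))" .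
  qed simp
  also have "PiM I M = PiM I (\<lambda>i. density lborel (g i))"
    by (rule PiM_cong) (auto simp: M_def)
  finally show ?thesis ..
qed

section \<open>Integration against the Aitchison measure\<close>

lemma closure_op_measurable [measurable]:
  "closure_op n \<in> measurable (PiM {..<n} (\<lambda>_. borel)) (PiM {..<n} (\<lambda>_. borel))"
  unfolding closure_op_def by measurable

lemma sets_aitchison [simp, measurable_cong]: "sets (aitchison n) = sets (PiM {..<n} (\<lambda>_. borel))"
  by (simp add: aitchison_def)

lemma nn_integral_aitchison:
  assumes [measurable]: "h \<in> borel_measurable (PiM {..<n} (\<lambda>_. borel))"
  shows "(\<integral>\<^sup>+y. h y \<partial>aitchison n)
    = (\<integral>\<^sup>+y. ennreal (1 / (sqrt (real n) * (\<Prod>i<n. chart_embed n y i))) * h (chart_embed n y)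
        * indicator (chart_dom n) y \<partial>PiM {..<n - 1} (\<lambda>_. lborel))"
proof -
  have [measurable]: "chart_embed n \<in> measurable (restrict_space (PiM {..<n - 1} (\<lambda>_. lborel)) (chart_dom n)) (PiM {..<n} (\<lambda>_. borel))"
    by (rule measurable_restrict_space1) (rule chart_measurable_lborel)
  show ?thesis
    unfolding aitchison_def
    by (subst nn_integral_density, measurable)
      (subst nn_integral_distr, measurable, subst nn_integral_restrict_space, measurable)
qed

text \<open>The exponents are \<open>\<alpha> i\<close>, not \<open>\<alpha> i - 1\<close> as in the
  familiar Lebesgue density, because the reference measure already carries the factor
  \<open>1 / prod y_i\<close>. The \<open>sqrt n\<close> compensates its normalisation.\<close>

definition sd_density :: "nat \<Rightarrow> (nat \<Rightarrow> real) \<Rightarrow> (nat \<Rightarrow> real) \<Rightarrow> (nat \<Rightarrow> real) \<Rightarrow> real" where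
  "sd_density n \<alpha> \<beta> y = sqrt (real n) * Gamma (\<Sum>i<n. \<alpha> i)
     * (\<Prod>i<n. (\<beta> i * y i) powr \<alpha> i / Gamma (\<alpha> i)) / (\<Sum>i<n. \<beta> i * y i) powr (\<Sum>i<n. \<alpha> i)"

lemma sd_density_measurable [measurable]:
  "sd_density n \<alpha> \<beta> \<in> borel_measurable (PiM {..<n} (\<lambda>_. borel))"
  unfolding sd_density_def by measurable

lemma chart_embed_simplex:
  assumes "n \<ge> 2" "y \<in> chart_dom n"
  shows "chart_embed n y \<in> open_simplex n"
proof -
  obtain m where n: "n = Suc m" using assms by (cases n) auto
  have pos: "\<And>i. i < m \<Longrightarrow> 0 < y i" "\<And>i. i < m \<Longrightarrow> y i < 1" and lt: "(\<Sum>i<m. y i) < 1"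
    using assms by (auto simp: chart_dom_def n)
  have "(\<Sum>i<m. y i) \<ge> 0" using pos by (intro sum_nonneg) (auto intro: less_imp_le)
  then show ?thesis
    using pos lt by (auto simp: open_simplex_def chart_embed_def n less_Suc_eq less_imp_le)
qed

lemma sum_pos_lessThan:
  fixes f :: "nat \<Rightarrow> real"
  assumes "n > 0" "\<And>i. i < n \<Longrightarrow> f i > 0"
  shows "(\<Sum>i<n. f i) > 0"
  using assms by (intro sum_pos) auto

text \<open>Along a ray the product of gamma densities is, up to a factor free of \<open>s\<close>,
  again a gamma integrand, with shape \<open>sum \<alpha>\<close> and rate
  \<open>sum (\<beta> i * e i)\<close>. The \<open>n\<close> exponents \<open>\<alpha> i - 1\<close>
  produce \<open>s ^ n\<close> in the denominator; against the Jacobian \<open>s ^ (n - 1)\<close> a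
  single \<open>1 / s\<close> survives, which is what the gamma integral requires.\<close>

lemma nn_integral_ray:
  fixes e \<alpha> \<beta> :: "nat \<Rightarrow> real"
  assumes n: "n > 0" and \<alpha>: "\<And>i. i < n \<Longrightarrow> \<alpha> i > 0" and \<beta>: "\<And>i. i < n \<Longrightarrow> \<beta> i > 0"
    and e: "\<And>i. i < n \<Longrightarrow> e i > 0"
  shows "(\<integral>\<^sup>+s. ennreal (s ^ (n - 1)) * (\<Prod>i<n. ennreal (gamma_density (\<alpha> i) (\<beta> i) (s * e i))) * indicator {0<..} s \<partial>lborel)
    = ennreal (1 / (sqrt (real n) * (\<Prod>i<n. e i))) * ennreal (sd_density n \<alpha> \<beta> e)"
proof -
  define a where "a = (\<Sum>i<n. \<alpha> i)"
  define b where "b = (\<Sum>i<n. \<beta> i * e i)"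
  define D where "D = (\<Prod>i<n. (\<beta> i * e i) powr \<alpha> i / Gamma (\<alpha> i)) / (\<Prod>i<n. e i)"
  have a: "a > 0" and b: "b > 0"
    unfolding a_def b_def using assms by (auto intro!: sum_pos_lessThan mult_pos_pos)
  have D: "D > 0"
    unfolding D_def
  proof (intro divide_pos_pos prod_pos ballI)
    fix i assume "i \<in> {..<n}"
    then have "\<beta> i * e i > 0" using \<beta> e by simp
    then show "(\<beta> i * e i) powr \<alpha> i > 0" by (metis powr_gt_zero less_irrefl)
  qed (use \<alpha> e in auto)
  have eq: "s ^ (n - 1) * (\<Prod>i<n. gamma_density (\<alpha> i) (\<beta> i) (s * e i))
    = D * (s powr (a - 1) * exp (- b * s))" if s: "s > 0" for s
  proof -
    have "(\<Prod>i<n. gamma_density (\<alpha> i) (\<beta> i) (s * e i))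
      = (\<Prod>i<n. ((\<beta> i * e i) powr \<alpha> i / Gamma (\<alpha> i) / e i) * (s powr \<alpha> i * (1 / s) * exp (- (\<beta> i * e i * s))))"
    proof (intro prod.cong refl)
      fix i assume "i \<in> {..<n}"
      then have i: "\<alpha> i > 0" "\<beta> i > 0" "e i > 0" using assms by auto
      have h: "(s * e i) powr (\<alpha> i - 1) = (s powr \<alpha> i / s) * (e i powr \<alpha> i / e i)"
        using s i by (simp add: powr_diff powr_mult)
      have "gamma_density (\<alpha> i) (\<beta> i) (s * e i)
        = \<beta> i powr \<alpha> i * ((s * e i) powr (\<alpha> i - 1)) * exp (- \<beta> i * (s * e i)) / Gamma (\<alpha> i)"
        using s i by (simp add: gamma_density_def)
      then show "gamma_density (\<alpha> i) (\<beta> i) (s * e i)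
        = ((\<beta> i * e i) powr \<alpha> i / Gamma (\<alpha> i) / e i) * (s powr \<alpha> i * (1 / s) * exp (- (\<beta> i * e i * s)))"
        unfolding h using s i by (simp add: powr_mult mult_ac)
    qed
    also have "\<dots> = D * (s powr a * (1 / s) ^ n * exp (- b * s))"
      using s by (simp add: prod.distrib D_def prod_dividef powr_sum a_def b_def exp_sum sum_distrib_right
          power_one_over flip: sum_negf)
    also have "s ^ (n - 1) * \<dots> = D * (s powr a / s * exp (- b * s))"
      using s n by (cases n) (auto simp: field_simps power_divide)
    also have "s powr a / s = s powr (a - 1)"
      using s by (simp add: powr_diff)
    finally show ?thesis .
  qed
  have "(\<integral>\<^sup>+s. ennreal (s ^ (n - 1)) * (\<Prod>i<n. ennreal (gamma_density (\<alpha> i) (\<beta> i) (s * e i))) * indicator {0<..} s \<partial>lborel)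
    = (\<integral>\<^sup>+s. ennreal D * (ennreal (s powr (a - 1) * exp (- b * s)) * indicator {0<..} s) \<partial>lborel)"
  proof (rule nn_integral_cong)
    fix s :: real
    show "ennreal (s ^ (n - 1)) * (\<Prod>i<n. ennreal (gamma_density (\<alpha> i) (\<beta> i) (s * e i))) * indicator {0<..} s
      = ennreal D * (ennreal (s powr (a - 1) * exp (- b * s)) * indicator {0<..} s)"
    proof (cases "s > 0")
      case True
      have "(\<Prod>i<n. ennreal (gamma_density (\<alpha> i) (\<beta> i) (s * e i))) = ennreal (\<Prod>i<n. gamma_density (\<alpha> i) (\<beta> i) (s * e i))"
        using \<alpha> by (intro prod_ennreal gamma_density_nonneg) auto
      then show ?thesis
        using True D eq[OF True] by (simp flip: ennreal_mult')
    qed simp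
  qed
  also have "\<dots> = ennreal D * (\<integral>\<^sup>+s. ennreal (s powr (a - 1) * exp (- b * s)) * indicator {0<..} s \<partial>lborel)"
    by (rule nn_integral_cmult) simp
  also have "\<dots> = ennreal (D * (Gamma a / b powr a))"
    using D by (simp only: nn_integral_gamma[OF a b] flip: ennreal_mult')
  also have "\<dots> = ennreal (1 / (sqrt (real n) * (\<Prod>i<n. e i))) * ennreal (sd_density n \<alpha> \<beta> e)"
  proof -
    have "(\<Prod>i<n. e i) > 0" using e by (intro prod_pos) auto
    then have "D * (Gamma a / b powr a) = 1 / (sqrt (real n) * (\<Prod>i<n. e i)) * sd_density n \<alpha> \<beta> e"
      using n by (simp add: sd_density_def D_def a_def b_def)
    then show ?thesis
      using \<open>(\<Prod>i<n. e i) > 0\<close> by (simp add: ennreal_mult'[symmetric])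
  qed
  finally show ?thesis .
qed

text \<open>Evaluated on a set \<open>A\<close>, the law integrates the joint density times the
  indicator of \<open>A\<close> at the closure of \<open>x\<close>. The closure is constant along
  rays, so this indicator leaves the inner integral and only the ray integral of the gamma densities
  remains.\<close>

lemma scaled_dirichlet_density:
  assumes n: "n \<ge> 2" and \<alpha>: "\<And>i. i < n \<Longrightarrow> \<alpha> i > 0" and \<beta>: "\<And>i. i < n \<Longrightarrow> \<beta> i > 0"
  shows "scaled_dirichlet n \<alpha> \<beta> = density (aitchison n) (\<lambda>y. ennreal (sd_density n \<alpha> \<beta> y))"
proof (rule measure_eqI)
  show "sets (scaled_dirichlet n \<alpha> \<beta>) = sets (density (aitchison n) (\<lambda>y. ennreal (sd_density n \<alpha> \<beta> y)))"
    by (simp add: scaled_dirichlet_def)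
  fix A assume "A \<in> sets (scaled_dirichlet n \<alpha> \<beta>)"
  then have A [measurable]: "A \<in> sets (PiM {..<n} (\<lambda>_. borel))"
    by (simp add: scaled_dirichlet_def)
  let ?g = "\<lambda>i t. ennreal (gamma_density (\<alpha> i) (\<beta> i) t)"
  define H where "H x = (\<Prod>i<n. ?g i (x i)) * indicator A (closure_op n x)" for x
  have H [measurable]: "H \<in> borel_measurable (PiM {..<n} (\<lambda>_. borel))"
    unfolding H_def by measurable
  have G: "PiM {..<n} (\<lambda>i. density lborel (?g i)) = density (PiM {..<n} (\<lambda>_. lborel)) (\<lambda>x. \<Prod>i<n. ?g i (x i))"
    using \<alpha> \<beta> by (intro PiM_density_lborel)
      (auto intro!: prob_space_imp_sigma_finite prob_space_gamma)
  have closure_meas: "closure_op n \<in> measurable (PiM {..<n} (\<lambda>_. lborel)) (PiM {..<n} (\<lambda>_. borel))"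
    using closure_op_measurable[of n]
    by (subst measurable_cong_sets[OF sets_PiM_cong[OF refl] refl]) auto
  have "emeasure (scaled_dirichlet n \<alpha> \<beta>) A = (\<integral>\<^sup>+y. indicator A y \<partial>scaled_dirichlet n \<alpha> \<beta>)"
    by (rule nn_integral_indicator[symmetric]) (simp add: scaled_dirichlet_def)
  also have "\<dots> = (\<integral>\<^sup>+x. H x \<partial>PiM {..<n} (\<lambda>_. lborel))"
    unfolding scaled_dirichlet_def G H_def using closure_meas
    by (simp add: nn_integral_distr nn_integral_density del: nn_integral_indicator)
  \<comment> \<open>A nonpositive coordinate makes one gamma density vanish, so restricting to the
    orthant loses no mass.\<close>
  also have "\<dots> = (\<integral>\<^sup>+x. H x * indicator (positive_orthant n) x \<partial>PiM {..<n} (\<lambda>_. lborel))"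
  proof (rule nn_integral_cong)
    fix x :: "nat \<Rightarrow> real" assume x: "x \<in> space (PiM {..<n} (\<lambda>_. lborel))"
    show "H x = H x * indicator (positive_orthant n) x"
    proof (cases "x \<in> positive_orthant n")
      case False
      then obtain i where "i < n" "x i \<le> 0"
        using x by (force simp: positive_orthant_def space_PiM)
      then have "(\<Prod>i<n. ?g i (x i)) = 0"
        by (intro prod_zero) (auto intro!: bexI[of _ i] simp: gamma_density_def)
      then have "H x = 0" by (simp add: H_def)
      then show ?thesis by simp
    qed simp
  qed
  also have "\<dots> = (\<integral>\<^sup>+y. (\<integral>\<^sup>+s. ennreal (s ^ (n - 1)) * H (\<lambda>i\<in>{..<n}. s * chart_embed n y i) * indicator {0<..} s \<partial>lborel)
        * indicator (chart_dom n) y \<partial>PiM {..<n - 1} (\<lambda>_. lborel))"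
    using n H by (rule nn_integral_polar)
  also have "\<dots> = (\<integral>\<^sup>+y. ennreal (1 / (sqrt (real n) * (\<Prod>i<n. chart_embed n y i)))
      * (ennreal (sd_density n \<alpha> \<beta> (chart_embed n y)) * indicator A (chart_embed n y))
        * indicator (chart_dom n) y \<partial>PiM {..<n - 1} (\<lambda>_. lborel))"
  proof (rule nn_integral_cong)
    fix y :: "nat \<Rightarrow> real"
    show "(\<integral>\<^sup>+s. ennreal (s ^ (n - 1)) * H (\<lambda>i\<in>{..<n}. s * chart_embed n y i) * indicator {0<..} s \<partial>lborel)
        * indicator (chart_dom n) y
      = ennreal (1 / (sqrt (real n) * (\<Prod>i<n. chart_embed n y i)))
      * (ennreal (sd_density n \<alpha> \<beta> (chart_embed n y)) * indicator A (chart_embed n y))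
        * indicator (chart_dom n) y"
    proof (cases "y \<in> chart_dom n")
      case True
      define e where "e = chart_embed n y"
      have e: "\<And>i. i < n \<Longrightarrow> e i > 0" "(\<Sum>i<n. e i) = 1" "e \<in> extensional {..<n}"
        using chart_embed_simplex[OF n True] by (auto simp: open_simplex_def e_def PiE_iff)
      \<comment> \<open>The coordinates of \<open>e\<close> add up to one, so the sum dividing
        \<open>s * e\<close> is \<open>s\<close> itself.\<close>
      have cl: "closure_op n (\<lambda>i\<in>{..<n}. s * e i) = e" if "s > 0" for s
        using that e by (auto simp: closure_op_def fun_eq_iff extensional_def simp flip: sum_distrib_left)
      have "(\<integral>\<^sup>+s. ennreal (s ^ (n - 1)) * H (\<lambda>i\<in>{..<n}. s * e i) * indicator {0<..} s \<partial>lborel)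
        = (\<integral>\<^sup>+s. (ennreal (s ^ (n - 1)) * (\<Prod>i<n. ?g i (s * e i)) * indicator {0<..} s) * indicator A e \<partial>lborel)"
        by (intro nn_integral_cong) (auto simp: H_def cl indicator_def)
      also have "\<dots> = (\<integral>\<^sup>+s. ennreal (s ^ (n - 1)) * (\<Prod>i<n. ?g i (s * e i)) * indicator {0<..} s \<partial>lborel) * indicator A e"
        by (rule nn_integral_multc) simp
      also have "\<dots> = ennreal (1 / (sqrt (real n) * (\<Prod>i<n. e i))) * ennreal (sd_density n \<alpha> \<beta> e) * indicator A e"
        using n \<alpha> \<beta> e by (subst nn_integral_ray) auto
      finally show ?thesis
        using True by (simp add: e_def mult.assoc)
    qed simp
  qed
  also have "\<dots> = (\<integral>\<^sup>+y. ennreal (sd_density n \<alpha> \<beta> y) * indicator A y \<partial>aitchison n)"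
    by (subst nn_integral_aitchison) simp_all
  also have "\<dots> = emeasure (density (aitchison n) (\<lambda>y. ennreal (sd_density n \<alpha> \<beta> y))) A"
    by (subst emeasure_density) simp_all
  finally show "emeasure (scaled_dirichlet n \<alpha> \<beta>) A
    = emeasure (density (aitchison n) (\<lambda>y. ennreal (sd_density n \<alpha> \<beta> y))) A" .
qed

subsection \<open>Densities on the simplex\<close>

lemma open_simplexD:
  assumes "x \<in> open_simplex n"
  shows "\<And>i. i < n \<Longrightarrow> 0 < x i" "(\<Sum>i<n. x i) = 1" "x \<in> extensional {..<n}"
  using assms by (auto simp: open_simplex_def PiE_iff)

text \<open>The two halves of \<open>Gam\<close> have separate origins: the denominator, raised to
  \<open>sum \<pi> i / \<sigma> = 1 / \<sigma>\<close>, gives the logarithm of the weighted mean,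
  and the product of powers gives the weighted sum of logarithms. Splitting
  \<open>ln (\<pi> i)\<close> off the latter leaves the entropy term of
  \<open>log_const\<close>.\<close>

lemma sd_density_eq_exp_Gam:
  assumes n: "n \<ge> 2" and \<pi>: "\<pi> \<in> open_simplex n" and x: "x \<in> open_simplex n"
    and y: "y \<in> open_simplex n" and \<sigma>: "\<sigma> > 0"
  shows "sd_density n (\<lambda>i. \<pi> i / \<sigma>) (\<lambda>i. \<pi> i / x i) y = exp (log_const n \<pi> \<sigma> - Gam n \<pi> y x / \<sigma>)"
proof -
  note pos = open_simplexD(1)[OF \<pi>] open_simplexD(1)[OF x] open_simplexD(1)[OF y]
  define b where "b = (\<Sum>i<n. \<pi> i * (y i / x i))"
  have b: "b > 0"
    unfolding b_def using n pos by (intro sum_pos_lessThan) auto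
  have a: "(\<Sum>i<n. \<pi> i / \<sigma>) = 1 / \<sigma>"
    using open_simplexD(2)[OF \<pi>] by (simp flip: sum_divide_distrib)
  have fac: "(\<pi> i / x i * y i) powr (\<pi> i / \<sigma>) / Gamma (\<pi> i / \<sigma>)
    = exp (\<pi> i / \<sigma> * (ln (\<pi> i) + ln (y i / x i)) - ln_Gamma (\<pi> i / \<sigma>))" if i: "i < n" for i
  proof -
    have "ln (\<pi> i / x i * y i) = ln (\<pi> i) + ln (y i / x i)"
      using pos[OF i] by (simp add: ln_mult_pos ln_div)
    then show ?thesis
      using pos[OF i] \<sigma> by (simp add: powr_def exp_diff Gamma_real_pos_exp)
  qed
  have "sd_density n (\<lambda>i. \<pi> i / \<sigma>) (\<lambda>i. \<pi> i / x i) y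
    = sqrt n * Gamma (1 / \<sigma>) * (\<Prod>i<n. exp (\<pi> i / \<sigma> * (ln (\<pi> i) + ln (y i / x i)) - ln_Gamma (\<pi> i / \<sigma>))) / b powr (1 / \<sigma>)"
  proof -
    have "(\<Prod>i<n. (\<pi> i / x i * y i) powr (\<pi> i / \<sigma>) / Gamma (\<pi> i / \<sigma>))
      = (\<Prod>i<n. exp (\<pi> i / \<sigma> * (ln (\<pi> i) + ln (y i / x i)) - ln_Gamma (\<pi> i / \<sigma>)))"
      by (intro prod.cong refl fac) auto
    moreover have "(\<Sum>i<n. \<pi> i / x i * y i) = b"
      by (simp add: b_def)
    ultimately show ?thesis
      by (simp only: sd_density_def a)
  qed
  also have "\<dots> = exp (ln (sqrt n)) * exp (ln_Gamma (1 / \<sigma>))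
      * exp (\<Sum>i<n. \<pi> i / \<sigma> * (ln (\<pi> i) + ln (y i / x i)) - ln_Gamma (\<pi> i / \<sigma>)) / exp (ln b / \<sigma>)"
    using n b \<sigma> by (simp add: exp_sum powr_def Gamma_real_pos_exp)
  also have "\<dots> = exp (ln (sqrt n) + ln_Gamma (1 / \<sigma>)
      + (\<Sum>i<n. \<pi> i / \<sigma> * (ln (\<pi> i) + ln (y i / x i)) - ln_Gamma (\<pi> i / \<sigma>)) - ln b / \<sigma>)"
    by (simp only: exp_add exp_diff)
  also have "ln (sqrt n) + ln_Gamma (1 / \<sigma>)
      + (\<Sum>i<n. \<pi> i / \<sigma> * (ln (\<pi> i) + ln (y i / x i)) - ln_Gamma (\<pi> i / \<sigma>)) - ln b / \<sigma>
    = log_const n \<pi> \<sigma> - Gam n \<pi> y x / \<sigma>"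
    by (simp add: log_const_def Gam_def b_def sum_subtractf sum.distrib sum_divide_distrib algebra_simps diff_divide_distrib)
  finally show ?thesis .
qed

lemma continuous_on_Gam:
  assumes n: "n \<ge> 2" and \<pi>: "\<pi> \<in> open_simplex n" and x: "x \<in> open_simplex n"
  shows "continuous_on (open_simplex n) (\<lambda>y. Gam n \<pi> y x)"
proof -
  have coord: "continuous_on (open_simplex n) (\<lambda>y. y i :: real)" for i :: nat
    by (rule continuous_on_subset[OF continuous_on_product_coordinates]) simp
  have "(\<Sum>i<n. \<pi> i * (y i / x i)) > 0" if "y \<in> open_simplex n" for y
    using n open_simplexD(1)[OF \<pi>] open_simplexD(1)[OF x] open_simplexD(1)[OF that]
    by (intro sum_pos_lessThan) auto
  then show ?thesis
    unfolding Gam_def using open_simplexD(1)[OF x] open_simplexD(1)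
    by (intro continuous_intros coord) (fastforce dest: open_simplexD(1))+
qed

text \<open>Two sigma-algebras meet here: the measures live on the finite product over
  \<open>{..<n}\<close>, while open and closed sets refer to the product topology on all functions.
  On the finite product every coordinate from \<open>n\<close> on is constantly
  \<open>undefined\<close>, so each coordinate map is measurable.\<close>

lemma id_PiM_borel_measurable:
  "(\<lambda>x. x) \<in> measurable (PiM {..<n} (\<lambda>_. borel :: real measure)) (borel :: (nat \<Rightarrow> real) measure)"
proof (rule measurable_coordinatewise_then_product)
  fix i :: nat
  show "(\<lambda>x. x i) \<in> borel_measurable (PiM {..<n} (\<lambda>_. borel :: real measure))"
  proof (cases "i < n")
    case False
    then have "x i = undefined" if "x \<in> space (PiM {..<n} (\<lambda>_. borel :: real measure))" for x
      using that by (auto simp: space_PiM PiE_iff extensional_def)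
    then show ?thesis
      by (subst measurable_cong[where g = "\<lambda>_. undefined"]) auto
  qed simp
qed

lemma open_simplex_borel [measurable]: "open_simplex n \<in> sets borel"
proof -
  have "open_simplex n = {x \<in> space borel. (\<forall>i. n \<le> i \<longrightarrow> x i = undefined) \<and>
      (\<forall>i<n. 0 < x i \<and> x i \<le> 1) \<and> (\<Sum>i<n. x i) = 1}"
    by (auto simp: open_simplex_def PiE_iff extensional_def not_less)
  also have "\<dots> \<in> sets borel"
    by measurable
  finally show ?thesis .
qed

lemma borel_subset_simplex_sets:
  assumes "A \<in> sets borel" "A \<subseteq> open_simplex n"
  shows "A \<in> sets (PiM {..<n} (\<lambda>_. borel))"
proof -
  have "A = (\<lambda>x. x) -` A \<inter> space (PiM {..<n} (\<lambda>_. borel))"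
    using assms(2) by (auto simp: open_simplex_def space_PiM)
  then show ?thesis
    using measurable_sets[OF id_PiM_borel_measurable assms(1), of n] by simp
qed

lemma open_simplex_sets [measurable]: "open_simplex n \<in> sets (PiM {..<n} (\<lambda>_. borel))"
  by (rule borel_subset_simplex_sets) auto

lemma openin_simplex_sets:
  assumes "openin (top_of_set (open_simplex n)) G"
  shows "G \<in> sets (PiM {..<n} (\<lambda>_. borel))"
proof -
  obtain U where "open U" "G = open_simplex n \<inter> U"
    using assms by (auto simp: openin_open)
  then show ?thesis by (intro borel_subset_simplex_sets) auto
qed

text \<open>The Aitchison measure is formally a measure on the whole product space. It is carried by
  the image of the chart, and this allows formulas valid only on the simplex to be used under the
  integral.\<close>

lemma AE_aitchison_simplex:
  assumes "n \<ge> 2"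
  shows "AE y in aitchison n. y \<in> open_simplex n"
proof -
  have S: "{y \<in> space (aitchison n). y \<notin> open_simplex n} \<in> sets (PiM {..<n} (\<lambda>_. borel))"
    using sets.Diff[OF sets.top open_simplex_sets, of n]
    by (simp add: set_diff_eq aitchison_def)
  have "(\<integral>\<^sup>+y. indicator {y \<in> space (aitchison n). y \<notin> open_simplex n} y \<partial>aitchison n)
    = (\<integral>\<^sup>+y. 0 \<partial>PiM {..<n - 1} (\<lambda>_. lborel :: real measure))"
    using S chart_embed_simplex[OF assms]
    by (subst nn_integral_aitchison, simp, intro nn_integral_cong) (auto split: split_indicator)
  then show ?thesis
    using S by (subst AE_iff_measurable[OF _ refl]) auto
qed

section \<open>Positivity of the Aitchison measure on open sets\<close>

lemma emeasure_lborel_open_neq_0: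
  fixes X :: "real set"
  assumes "open X" "X \<noteq> {}"
  shows "emeasure lborel X \<noteq> 0"
proof -
  obtain a e where e: "e > 0" "ball a e \<subseteq> X"
    using assms open_contains_ball by (metis ex_in_conv)
  then have "emeasure lborel {a - e<..<a + e} \<le> emeasure lborel X"
    using assms by (intro emeasure_mono) (auto simp: ball_eq_greaterThanLessThan)
  moreover have "emeasure lborel {a - e<..<a + e} = ennreal (2 * e)"
    using e by (subst emeasure_lborel_Ioo) auto
  ultimately show ?thesis
    using e by (auto simp: ennreal_eq_0_iff)
qed

text \<open>In the chart, \<open>G\<close> contains an open box around the preimage of one of its
  points. The Aitchison weight is strictly positive there, so a null \<open>G\<close> would force
  this box to have Lebesgue measure zero.\<close>

lemma emeasure_aitchison_open_neq_0:
  assumes n: "n \<ge> 2" and G: "openin (top_of_set (open_simplex n)) G" and "G \<noteq> {}"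
  shows "emeasure (aitchison n) G \<noteq> 0"
proof
  assume null: "emeasure (aitchison n) G = 0"
  define m where "m = n - 1"
  have n_eq: "n = Suc m" using n by (simp add: m_def)
  obtain U where U: "open U" "G = open_simplex n \<inter> U"
    using G by (auto simp: openin_open)
  obtain y0 where y0: "y0 \<in> G" using \<open>G \<noteq> {}\<close> by blast
  then have y0S: "y0 \<in> open_simplex n" using U by auto
  define z0 where "z0 = restrict y0 {..<m}"
  have y0_last: "y0 m = 1 - (\<Sum>j<m. y0 j)"
    using open_simplexD(2)[OF y0S] by (simp add: n_eq)
  have emb0: "chart_embed n z0 = y0"
    using open_simplexD(3)[OF y0S] y0_last
    by (auto simp: chart_embed_def z0_def n_eq fun_eq_iff extensional_def less_Suc_eq)
  have cont: "continuous_on UNIV (chart_embed n)"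
  proof (rule continuous_on_coordinatewise_then_product)
    fix i
    show "continuous_on UNIV (\<lambda>y. chart_embed n y i)"
      by (cases "i < m"; cases "i < n")
        (auto simp: chart_embed_def n_eq intro!: continuous_intros continuous_on_product_coordinates)
  qed
  \<comment> \<open>\<open>W\<close> describes the chart preimage of \<open>G\<close> by strict
    inequalities on all functions, without demanding \<open>undefined\<close> outside the index set;
    this makes it open in the product topology.\<close>
  define W where "W = chart_embed n -` U \<inter> (\<Inter>i\<in>{..<m}. {z. 0 < z i} \<inter> {z. z i < 1}) \<inter> {z. (\<Sum>i<m. z i) < 1}"
  have "open W"
    unfolding W_def
    by (intro open_Int open_INT ballI open_Collect_less open_vimage[OF U(1) cont] finite_lessThan
        continuous_on_const continuous_on_sum continuous_on_product_coordinates)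
  have "y0 i < 1" if "i < m" for i
  proof -
    have "y0 i \<le> (\<Sum>j<m. y0 j)"
      using that open_simplexD(1)[OF y0S] by (intro member_le_sum) (auto simp: n_eq less_imp_le)
    then show ?thesis
      using open_simplexD(1)[OF y0S, of m] y0_last by (simp add: n_eq)
  qed
  moreover have "(\<Sum>j<m. y0 j) < 1"
    using open_simplexD(1)[OF y0S, of m] y0_last by (simp add: n_eq)
  ultimately have "z0 \<in> W"
    using y0 U open_simplexD(1)[OF y0S] emb0
    by (auto simp: W_def z0_def n_eq less_Suc_eq)
  then obtain X where X: "z0 \<in> Pi\<^sub>E UNIV X" "\<And>i. open (X i)" "Pi\<^sub>E UNIV X \<subseteq> W"
    using product_topology_open_contains_basis[of "\<lambda>_. euclidean" UNIV W z0] \<open>open W\<close>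
    by (auto simp: open_fun_def)
  \<comment> \<open>The basic box constrains all coordinates, but the measure sees only the first
    \<open>m\<close>. The others of \<open>z\<close> equal \<open>undefined\<close>, as do those of
    \<open>z0\<close>, so they lie in \<open>X i\<close> automatically.\<close>
  have box_W: "Pi\<^sub>E {..<m} X \<subseteq> W"
  proof
    fix z assume "z \<in> Pi\<^sub>E {..<m} X"
    then have "z i \<in> X i" for i
      using PiE_mem[OF X(1), of i] by (cases "i < m") (auto simp: PiE_iff z0_def extensional_def)
    then show "z \<in> W" using X(3) by auto
  qed
  have box: "Pi\<^sub>E {..<m} X \<in> sets (PiM {..<m} (\<lambda>_. lborel))"
    using X(2) by (intro sets_PiM_I_finite) auto
  have G_sets: "G \<in> sets (PiM {..<n} (\<lambda>_. borel))"
    using G by (rule openin_simplex_sets)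
  then have "(\<integral>\<^sup>+y. ennreal (1 / (sqrt (real n) * (\<Prod>i<n. chart_embed n y i))) * indicator G (chart_embed n y)
        * indicator (chart_dom n) y \<partial>PiM {..<n - 1} (\<lambda>_. lborel)) = 0" (is "(\<integral>\<^sup>+y. ?h y \<partial>_) = 0")
    using null by (subst nn_integral_aitchison[symmetric]) auto
  moreover have "?h \<in> borel_measurable (PiM {..<n - 1} (\<lambda>_. lborel))"
    using chart_measurable_lborel[of n] G_sets by measurable
  ultimately have "AE y in PiM {..<m} (\<lambda>_. lborel). ?h y = 0"
    unfolding m_def by (subst (asm) nn_integral_0_iff_AE)
  moreover have "?h y \<noteq> 0" if y: "y \<in> Pi\<^sub>E {..<m} X" for y
  proof -
    have "y \<in> chart_dom n" "chart_embed n y \<in> U"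
      using subsetD[OF box_W y] y by (auto simp: W_def chart_dom_def n_eq PiE_iff)
    moreover from this have "chart_embed n y \<in> open_simplex n"
      using n by (intro chart_embed_simplex)
    moreover from this have "(\<Prod>i<n. chart_embed n y i) > 0"
      using open_simplexD(1) by (intro prod_pos) auto
    ultimately show ?thesis
      using U n by (auto simp: ennreal_eq_0_iff not_le)
  qed
  ultimately have "AE y in PiM {..<m} (\<lambda>_. lborel). y \<notin> Pi\<^sub>E {..<m} X"
    by (auto elim: eventually_mono)
  then have "emeasure (PiM {..<m} (\<lambda>_. lborel)) (Pi\<^sub>E {..<m} X) = 0"
    using box by (subst (asm) AE_iff_measurable[OF box]) (auto simp: space_PiM)
  moreover have "emeasure (PiM {..<m} (\<lambda>_. lborel)) (Pi\<^sub>E {..<m} X) = (\<Prod>i<m. emeasure lborel (X i))"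
    using X(2) by (intro lborel_PiM.emeasure_PiM) auto
  moreover have "(\<Prod>i<m. emeasure lborel (X i)) \<noteq> 0"
    using X(1,2) emeasure_lborel_open_neq_0 by (auto simp: PiE_iff)
  ultimately show False by simp
qed

section \<open>The laws \<open>mu\<close> and uniqueness of their continuous densities\<close>

lemma mu_eq_density:
  assumes "n \<ge> 2" "\<pi> \<in> open_simplex n" "x \<in> open_simplex n" "\<sigma> > 0"
  shows "mu n \<pi> x \<sigma> = density (aitchison n) (\<lambda>y. ennreal (sd_density n (\<lambda>i. \<pi> i / \<sigma>) (\<lambda>i. \<pi> i / x i) y))"
  unfolding mu_def using assms open_simplexD(1) by (intro scaled_dirichlet_density) auto

lemma prob_space_mu:
  assumes "n \<ge> 2" "\<pi> \<in> open_simplex n" "x \<in> open_simplex n" "\<sigma> > 0"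
  shows "prob_space (mu n \<pi> x \<sigma>)"
proof -
  have pos: "\<pi> i / \<sigma> > 0" "\<pi> i / x i > 0" if "i \<in> {..<n}" for i
    using that assms open_simplexD(1) by auto
  have "closure_op n \<in> measurable (PiM {..<n} (\<lambda>i. density lborel (\<lambda>t. ennreal (gamma_density (\<pi> i / \<sigma>) (\<pi> i / x i) t))))
      (PiM {..<n} (\<lambda>_. borel))"
    using closure_op_measurable[of n]
    by (subst measurable_cong_sets[OF sets_PiM_cong[OF refl] refl]) auto
  then show ?thesis
    unfolding mu_def scaled_dirichlet_def using pos
    by (intro prob_space.prob_space_distr prob_space_PiM prob_space_gamma) auto
qed

text \<open>Equal densities agree almost everywhere. The set where two continuous ones differ is
  relatively open, so if it were nonempty it would have positive Aitchison mass.\<close>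

lemma continuous_density_unique:
  fixes f g :: "(nat \<Rightarrow> real) \<Rightarrow> real"
  assumes n: "n \<ge> 2"
    and f: "continuous_on (open_simplex n) f" "\<And>y. y \<in> open_simplex n \<Longrightarrow> 0 \<le> f y"
    and g: "continuous_on (open_simplex n) g" "\<And>y. y \<in> open_simplex n \<Longrightarrow> 0 \<le> g y"
    and eq: "density (aitchison n) (\<lambda>y. ennreal (f y)) = density (aitchison n) (\<lambda>y. ennreal (g y))"
    and fin: "finite_measure (density (aitchison n) (\<lambda>y. ennreal (g y)))"
    and y: "y \<in> open_simplex n"
  shows "f y = g y"
proof (rule ccontr)
  assume neq: "f y \<noteq> g y"
  let ?S = "open_simplex n" and ?N = "aitchison n"
  \<comment> \<open>\<open>f\<close> and \<open>g\<close> need not be measurable off the simplex, so they are cut off to it first.\<close>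
  define r where "r h y = indicator ?S y *\<^sub>R h y" for h :: "(nat \<Rightarrow> real) \<Rightarrow> real" and y
  have r_meas: "r h \<in> borel_measurable ?N" if "continuous_on ?S h" for h
  proof -
    have "r h \<in> borel_measurable borel"
      unfolding r_def using that by (rule borel_measurable_continuous_on_indicator[OF open_simplex_borel])
    from measurable_compose[OF id_PiM_borel_measurable this]
    show ?thesis by simp
  qed
  have r_density: "density ?N (\<lambda>y. ennreal (h y)) = density ?N (\<lambda>y. ennreal (r h y))" for h
  proof -
    \<comment> \<open>A density measure is defined through these integrals alone, so equality off a
      null set is enough even for an \<open>h\<close> that is not measurable.\<close>
    have "(\<integral>\<^sup>+y. ennreal (h y) * indicator A y \<partial>?N) = (\<integral>\<^sup>+y. ennreal (r h y) * indicator A y \<partial>?N)" for A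
      using AE_aitchison_simplex[OF n] by (intro nn_integral_cong_AE) (auto simp: r_def)
    then show ?thesis unfolding density_def by presburger
  qed
  have "AE y in ?N. ennreal (r f y) = ennreal (r g y)"
  \<comment> \<open>The required sigma-finiteness is that of the density measure, so it comes from
    the finiteness of the law and not from the infinite reference measure.\<close>
  proof (rule sigma_finite_density_unique[THEN iffD1])
    have "density ?N (\<lambda>y. ennreal (r f y)) = density ?N (\<lambda>y. ennreal (g y))"
      using eq r_density[of f] by simp
    then show "sigma_finite_measure (density ?N (\<lambda>y. ennreal (r f y)))"
      using fin by (simp add: finite_measure_def)
    show "density ?N (\<lambda>y. ennreal (r f y)) = density ?N (\<lambda>y. ennreal (r g y))"
      using eq r_density[of f] r_density[of g] by simp
  qed (use r_meas[OF f(1)] r_meas[OF g(1)] in measurable)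
  then have AE: "AE y in ?N. f y = g y"
    using AE_aitchison_simplex[OF n] by eventually_elim (use f g in \<open>auto simp: r_def\<close>)
  define G where "G = {y \<in> ?S. f y - g y \<in> - {0}}"
  have G: "openin (top_of_set ?S) G"
    unfolding G_def using continuous_openin_preimage_gen[of ?S "\<lambda>y. f y - g y" "- {0}"] f g
    by (auto simp: vimage_def Int_def intro!: continuous_intros)
  have "emeasure ?N G \<noteq> 0"
    using n G neq y by (intro emeasure_aitchison_open_neq_0) (auto simp: G_def)
  moreover have "emeasure ?N G = 0"
  proof -
    have "emeasure ?N G = emeasure ?N {}"
      using AE openin_simplex_sets[OF G] by (intro emeasure_eq_AE) (auto simp: G_def elim: eventually_mono)
    then show ?thesis by simp
  qed
  ultimately show False by simp
qed

subsection \<open>The large deviation principle\<close>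

text \<open>Bounding the density on \<open>F\<close> by its largest value would leave the factor
  \<open>aitchison F\<close>, possibly infinite. Instead one copy of \<open>exp (- Gam)\<close> is
  kept in the integral, where it forms the density of \<open>mu\<close> at 1, and only
  \<open>exp (- Gam * (1 / \<sigma> - 1))\<close> is estimated. The real bound \<open>c\<close>
  stands in for the infimum, which is infinite when \<open>F\<close> is empty.\<close>

lemma ldp_upper:
  assumes n: "n \<ge> 2" and \<pi>: "\<pi> \<in> open_simplex n" and x: "x \<in> open_simplex n"
    and c: "\<And>y. y \<in> F \<Longrightarrow> c \<le> Gam n \<pi> y x"
  shows "Limsup (at_right 0) (\<lambda>\<sigma>. slog \<sigma> (measure (mu n \<pi> x \<sigma>) F)) \<le> ereal (- c)"
proof -
  let ?L = "log_const n \<pi>"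
  \<comment> \<open>This is \<open>\<sigma> * ln C\<close> for the constant \<open>C\<close> below;
    it tends to \<open>- c\<close> because \<open>\<sigma> * log_const n \<pi> \<sigma>\<close>
    vanishes in the limit.\<close>
  let ?b = "\<lambda>\<sigma>. \<sigma> * ?L \<sigma> - \<sigma> * ?L 1 - c * (1 - \<sigma>)"
  have bound: "slog \<sigma> (measure (mu n \<pi> x \<sigma>) F) \<le> ereal (?b \<sigma>)" if \<sigma>: "0 < \<sigma>" "\<sigma> < 1" for \<sigma>
  proof (cases "F \<in> sets (PiM {..<n} (\<lambda>_. borel))")
    case False
    \<comment> \<open>Junk value: \<open>measure\<close> is 0 on non-measurable sets, so \<open>F\<close> may be arbitrary.\<close>
    then have "measure (mu n \<pi> x \<sigma>) F = 0"
      by (intro measure_notin_sets) (simp add: mu_def scaled_dirichlet_def)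
    then show ?thesis by (simp add: slog_def)
  next
    case True
    note [measurable] = True
    interpret M1: prob_space "mu n \<pi> x 1" using n \<pi> x by (intro prob_space_mu) auto
    interpret M: prob_space "mu n \<pi> x \<sigma>" using n \<pi> x \<sigma> by (intro prob_space_mu) auto
    \<comment> \<open>\<open>C\<close> bounds the ratio of the densities at \<sigma> and at 1 on
      \<open>F\<close>. The restriction to \<sigma> < 1 keeps \<open>1 / \<sigma> - 1\<close>
      nonnegative, so a lower bound on \<open>Gam\<close> is an upper bound on the ratio.\<close>
    define C where "C = exp (?L \<sigma> - ?L 1 - c * (1 / \<sigma> - 1))"
    let ?d = "\<lambda>\<sigma>. sd_density n (\<lambda>i. \<pi> i / \<sigma>) (\<lambda>i. \<pi> i / x i)"
    have le: "?d \<sigma> y \<le> C * ?d 1 y" if "y \<in> open_simplex n" "y \<in> F" for y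
    proof -
      have "c * (1 / \<sigma> - 1) \<le> Gam n \<pi> y x * (1 / \<sigma> - 1)"
        using c[OF that(2)] \<sigma> by (intro mult_right_mono) (auto simp: field_simps)
      then have "?L \<sigma> - Gam n \<pi> y x / \<sigma> \<le> (?L \<sigma> - ?L 1 - c * (1 / \<sigma> - 1)) + (?L 1 - Gam n \<pi> y x / 1)"
        by (simp add: algebra_simps)
      then show ?thesis
        using n \<pi> x \<sigma> that sd_density_eq_exp_Gam[OF n \<pi> x that(1) \<sigma>(1)] sd_density_eq_exp_Gam[OF n \<pi> x that(1), of 1]
        by (simp add: C_def flip: exp_add)
    qed
    have "emeasure (mu n \<pi> x \<sigma>) F = (\<integral>\<^sup>+y. ennreal (?d \<sigma> y) * indicator F y \<partial>aitchison n)"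
      using mu_eq_density[OF n \<pi> x \<sigma>(1)] by (simp add: emeasure_density)
    also have "\<dots> \<le> (\<integral>\<^sup>+y. ennreal C * (ennreal (?d 1 y) * indicator F y) \<partial>aitchison n)"
    proof (rule nn_integral_mono_AE)
      show "AE y in aitchison n. ennreal (?d \<sigma> y) * indicator F y \<le> ennreal C * (ennreal (?d 1 y) * indicator F y)"
        using AE_aitchison_simplex[OF n]
      proof eventually_elim
        case (elim y)
        then show ?case
          using le[of y] by (auto simp: indicator_def C_def simp flip: ennreal_mult' intro!: ennreal_leI)
      qed
    qed
    also have "\<dots> = ennreal C * emeasure (mu n \<pi> x 1) F"
      using mu_eq_density[OF n \<pi> x, of 1] by (simp add: emeasure_density nn_integral_cmult)
    also have "\<dots> \<le> ennreal C * 1"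
      by (intro mult_left_mono M1.emeasure_le_1) simp
    finally have le_C: "measure (mu n \<pi> x \<sigma>) F \<le> C"
      by (simp add: M.emeasure_eq_measure C_def)
    show ?thesis
    proof (cases "measure (mu n \<pi> x \<sigma>) F = 0")
      case False
      then have "measure (mu n \<pi> x \<sigma>) F > 0" by (simp add: zero_less_measure_iff)
      then have "ln (measure (mu n \<pi> x \<sigma>) F) \<le> ln C"
        using le_C by simp
      then have "\<sigma> * ln (measure (mu n \<pi> x \<sigma>) F) \<le> \<sigma> * (?L \<sigma> - ?L 1 - c * (1 / \<sigma> - 1))"
        using \<sigma> by (intro mult_left_mono) (auto simp: C_def)
      also have "\<dots> = ?b \<sigma>"
        using \<sigma> by (simp add: field_simps)
      finally show ?thesis
        using False by (simp add: slog_def)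
    qed (simp add: slog_def)
  qed
  have "(?b \<longlongrightarrow> 0 - 0 * ?L 1 - c * (1 - 0)) (at_right 0)"
    using log_const_limit[of n \<pi>] open_simplexD(1,2)[OF \<pi>] by (intro tendsto_intros) auto
  then have "((\<lambda>\<sigma>. ereal (?b \<sigma>)) \<longlongrightarrow> ereal (- c)) (at_right 0)"
    by simp
  then have "Limsup (at_right 0) (\<lambda>\<sigma>. ereal (?b \<sigma>)) = ereal (- c)"
    by (intro lim_imp_Limsup) auto
  moreover have "Limsup (at_right 0) (\<lambda>\<sigma>. slog \<sigma> (measure (mu n \<pi> x \<sigma>) F)) \<le> Limsup (at_right 0) (\<lambda>\<sigma>. ereal (?b \<sigma>))"
    using bound by (intro Limsup_mono eventually_at_rightI[of 0 1]) auto
  ultimately show ?thesis by simp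
qed

text \<open>By continuity \<open>Gam\<close> exceeds its value at \<open>y0\<close> by less than
  \<open>e\<close> on a relatively open neighbourhood of \<open>y0\<close> inside \<open>G\<close>.
  Its Aitchison mass is positive and independent of \<sigma>, so its logarithm disappears after
  multiplication by \<sigma>.\<close>

lemma ldp_lower:
  assumes n: "n \<ge> 2" and \<pi>: "\<pi> \<in> open_simplex n" and x: "x \<in> open_simplex n"
    and G: "openin (top_of_set (open_simplex n)) G" and y0: "y0 \<in> G"
  shows "ereal (- Gam n \<pi> y0 x) \<le> Liminf (at_right 0) (\<lambda>\<sigma>. slog \<sigma> (measure (mu n \<pi> x \<sigma>) G))"
proof (rule ereal_le_epsilon2)
  fix e :: real assume e: "e > 0"
  let ?L = "log_const n \<pi>" and ?S = "open_simplex n"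
  define c where "c = Gam n \<pi> y0 x + e"
  define V where "V = G \<inter> {y \<in> ?S. Gam n \<pi> y x \<in> {..<c}}"
  have V: "openin (top_of_set ?S) V"
    unfolding V_def
    using continuous_openin_preimage_gen[OF continuous_on_Gam[OF n \<pi> x] open_lessThan[of c]] G
    by (intro openin_Int) (auto simp: vimage_def Int_def)
  have "y0 \<in> V"
    using y0 e openin_subset[OF G] by (auto simp: V_def c_def)
  then have "emeasure (aitchison n) V \<noteq> 0"
    using n V by (intro emeasure_aitchison_open_neq_0) auto
  \<comment> \<open>The neighbourhood may have infinite Aitchison mass, so a positive real lower
    bound \<open>p\<close> replaces the mass itself and its logarithm makes sense.\<close>
  then obtain p where p: "p > 0" "ennreal p \<le> emeasure (aitchison n) V"
  proof (cases "emeasure (aitchison n) V")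
    case (real r)
    then show ?thesis using \<open>emeasure (aitchison n) V \<noteq> 0\<close> by (intro that[of r]) auto
  next
    case top
    then show ?thesis by (intro that[of 1]) auto
  qed
  note [measurable] = openin_simplex_sets[OF V] openin_simplex_sets[OF G]
  let ?b = "\<lambda>\<sigma>. \<sigma> * ln p + \<sigma> * ?L \<sigma> - c"
  have bound: "ereal (?b \<sigma>) \<le> slog \<sigma> (measure (mu n \<pi> x \<sigma>) G)" if \<sigma>: "0 < \<sigma>" for \<sigma>
  proof -
    interpret M: prob_space "mu n \<pi> x \<sigma>" using n \<pi> x \<sigma> by (intro prob_space_mu) auto
    let ?d = "\<lambda>\<sigma>. sd_density n (\<lambda>i. \<pi> i / \<sigma>) (\<lambda>i. \<pi> i / x i)"
    define C where "C = exp (?L \<sigma> - c / \<sigma>)"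
    have le: "C \<le> ?d \<sigma> y" if "y \<in> V" for y
    proof -
      have y: "y \<in> ?S" "Gam n \<pi> y x \<le> c" using that by (auto simp: V_def)
      then have "Gam n \<pi> y x / \<sigma> \<le> c / \<sigma>"
        using \<sigma> by (intro divide_right_mono) auto
      then show ?thesis
        using sd_density_eq_exp_Gam[OF n \<pi> x y(1) \<sigma>] by (simp add: C_def)
    qed
    have "ennreal (p * C) \<le> ennreal C * emeasure (aitchison n) V"
      using p mult_left_mono[OF p(2), of "ennreal C"] by (simp add: ennreal_mult C_def mult.commute)
    also have "\<dots> = (\<integral>\<^sup>+y. ennreal C * indicator V y \<partial>aitchison n)"
      by (simp add: nn_integral_cmult_indicator)
    also have "\<dots> \<le> (\<integral>\<^sup>+y. ennreal (?d \<sigma> y) * indicator G y \<partial>aitchison n)"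
      using le by (intro nn_integral_mono) (auto simp: indicator_def V_def intro!: ennreal_leI)
    also have "\<dots> = emeasure (mu n \<pi> x \<sigma>) G"
      using mu_eq_density[OF n \<pi> x \<sigma>] by (simp add: emeasure_density)
    finally have ge: "p * C \<le> measure (mu n \<pi> x \<sigma>) G"
      by (simp add: M.emeasure_eq_measure)
    have pC: "p * C > 0" using p by (simp add: C_def)
    have "?b \<sigma> = \<sigma> * ln (p * C)"
      using p \<sigma> by (simp add: C_def ln_mult_pos algebra_simps)
    also have "\<dots> \<le> \<sigma> * ln (measure (mu n \<pi> x \<sigma>) G)"
      using \<sigma> ge pC by (intro mult_left_mono) auto
    finally show ?thesis
      using ge pC by (simp add: slog_def)
  qed
  have "(?b \<longlongrightarrow> 0 * ln p + 0 - c) (at_right 0)"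
    using log_const_limit[of n \<pi>] open_simplexD(1,2)[OF \<pi>] by (intro tendsto_intros) auto
  then have "((\<lambda>\<sigma>. ereal (?b \<sigma>)) \<longlongrightarrow> ereal (- c)) (at_right 0)"
    by simp
  then have "Liminf (at_right 0) (\<lambda>\<sigma>. ereal (?b \<sigma>)) = ereal (- c)"
    by (intro lim_imp_Liminf) auto
  moreover have "Liminf (at_right 0) (\<lambda>\<sigma>. ereal (?b \<sigma>)) \<le> Liminf (at_right 0) (\<lambda>\<sigma>. slog \<sigma> (measure (mu n \<pi> x \<sigma>) G))"
    using bound by (intro Liminf_mono eventually_at_rightI[of 0 1]) auto
  ultimately have "ereal (- c) \<le> Liminf (at_right 0) (\<lambda>\<sigma>. slog \<sigma> (measure (mu n \<pi> x \<sigma>) G))"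
    by simp
  then show "ereal (- Gam n \<pi> y0 x) \<le> Liminf (at_right 0) (\<lambda>\<sigma>. slog \<sigma> (measure (mu n \<pi> x \<sigma>) G)) + ereal e"
    unfolding c_def by (cases "Liminf (at_right 0) (\<lambda>\<sigma>. slog \<sigma> (measure (mu n \<pi> x \<sigma>) G))") auto
qed

theorem mainTheorem4:
  fixes n :: nat and \<pi> :: "nat \<Rightarrow> real"
  assumes "n \<ge> 2" and "\<pi> \<in> open_simplex n"
  shows "((\<exists>f. is_cont_density n \<pi> f) \<and>
          (\<forall>f. is_cont_density n \<pi> f \<longrightarrow>
             (\<forall>\<epsilon>>0. \<exists>\<delta>>0. \<forall>\<sigma>. 0 < \<sigma> \<and> \<sigma> < \<delta> \<longrightarrow>
                (\<forall>x\<in>open_simplex n. \<forall>y\<in>open_simplex n.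
                   \<bar>- \<sigma> * ln (f \<sigma> x y) - Gam n \<pi> y x\<bar> \<le> \<epsilon>))))
       \<and> (\<forall>x\<in>open_simplex n.
            (\<forall>F. closedin (top_of_set (open_simplex n)) F \<longrightarrow>
               Limsup (at_right 0) (\<lambda>\<sigma>. slog \<sigma> (measure (mu n \<pi> x \<sigma>) F))
                 \<le> - (INF y\<in>F. ereal (Gam n \<pi> y x))) \<and>
            (\<forall>G. openin (top_of_set (open_simplex n)) G \<longrightarrow>
               Liminf (at_right 0) (\<lambda>\<sigma>. slog \<sigma> (measure (mu n \<pi> x \<sigma>) G))
                 \<ge> - (INF y\<in>G. ereal (Gam n \<pi> y x))))"
proof (intro conjI ballI allI impI)
  note n = assms(1) and \<pi> = assms(2)
  let ?S = "open_simplex n"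
  define d where "d \<sigma> x = sd_density n (\<lambda>i. \<pi> i / \<sigma>) (\<lambda>i. \<pi> i / x i)" for \<sigma> and x :: "nat \<Rightarrow> real"
  have d_exp: "d \<sigma> x y = exp (log_const n \<pi> \<sigma> - Gam n \<pi> y x / \<sigma>)"
    if "\<sigma> > 0" "x \<in> ?S" "y \<in> ?S" for \<sigma> x y
    unfolding d_def using n \<pi> that by (intro sd_density_eq_exp_Gam)
  have d_cont: "continuous_on ?S (d \<sigma> x)" if "\<sigma> > 0" "x \<in> ?S" for \<sigma> x
  proof -
    have "continuous_on ?S (\<lambda>y. exp (log_const n \<pi> \<sigma> - Gam n \<pi> y x / \<sigma>))"
      using that by (intro continuous_intros continuous_on_Gam n \<pi>) auto
    then show ?thesis
      using that d_exp by (subst continuous_on_cong[OF refl]) auto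
  qed
  have d_density: "mu n \<pi> x \<sigma> = density (aitchison n) (\<lambda>y. ennreal (d \<sigma> x y))"
    if "\<sigma> > 0" "x \<in> ?S" for \<sigma> x
    unfolding d_def using n \<pi> that by (intro mu_eq_density)
  show "\<exists>f. is_cont_density n \<pi> f"
    using d_cont d_density d_exp by (intro exI[of _ d]) (auto simp: is_cont_density_def)
  fix f and \<epsilon> :: real
  assume f: "is_cont_density n \<pi> f" and \<epsilon>: "\<epsilon> > 0"
  \<comment> \<open>An arbitrary continuous density is identified with the explicit one at every
    point of the simplex, not merely almost everywhere.\<close>
  have f_eq: "f \<sigma> x y = d \<sigma> x y" if "\<sigma> > 0" "x \<in> ?S" "y \<in> ?S" for \<sigma> x y
  proof (rule continuous_density_unique[OF n, where f = "f \<sigma> x" and g = "d \<sigma> x" and y = y])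
    show "density (aitchison n) (\<lambda>y. ennreal (f \<sigma> x y)) = density (aitchison n) (\<lambda>y. ennreal (d \<sigma> x y))"
      using f that d_density[OF that(1,2)] by (simp add: is_cont_density_def)
    show "finite_measure (density (aitchison n) (\<lambda>y. ennreal (d \<sigma> x y)))"
      using prob_space_mu[OF n \<pi> that(2,1)] d_density[OF that(1,2)] by (simp add: prob_space_def)
  qed (use f that d_cont d_exp in \<open>auto simp: is_cont_density_def\<close>)
  have "((\<lambda>\<sigma>. \<sigma> * log_const n \<pi> \<sigma>) \<longlongrightarrow> 0) (at_right 0)"
    using open_simplexD(1,2)[OF \<pi>] by (intro log_const_limit) auto
  from tendstoD[OF this \<epsilon>] obtain \<delta> where \<delta>: "\<delta> > 0"
    "\<And>\<sigma>. 0 < \<sigma> \<Longrightarrow> \<sigma> < \<delta> \<Longrightarrow> \<bar>\<sigma> * log_const n \<pi> \<sigma>\<bar> < \<epsilon>"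
    by (auto simp: eventually_at_right_field)
  show "\<exists>\<delta>>0. \<forall>\<sigma>. 0 < \<sigma> \<and> \<sigma> < \<delta> \<longrightarrow>
      (\<forall>x\<in>?S. \<forall>y\<in>?S. \<bar>- \<sigma> * ln (f \<sigma> x y) - Gam n \<pi> y x\<bar> \<le> \<epsilon>)"
  proof (intro exI[of _ \<delta>] conjI allI impI ballI \<delta>(1))
    fix \<sigma> x y assume \<sigma>: "0 < \<sigma> \<and> \<sigma> < \<delta>" and xy: "x \<in> ?S" "y \<in> ?S"
    \<comment> \<open>The difference involves neither \<open>x\<close> nor \<open>y\<close>, so the
      threshold chosen for \<open>log_const\<close> alone is uniform.\<close>
    have "- \<sigma> * ln (f \<sigma> x y) - Gam n \<pi> y x = - (\<sigma> * log_const n \<pi> \<sigma>)"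
      using \<sigma> xy by (simp add: f_eq d_exp algebra_simps)
    then show "\<bar>- \<sigma> * ln (f \<sigma> x y) - Gam n \<pi> y x\<bar> \<le> \<epsilon>"
      using \<delta>(2)[of \<sigma>] \<sigma> by simp
  qed
next
  fix x F assume x: "x \<in> open_simplex n"
  let ?U = "Limsup (at_right 0) (\<lambda>\<sigma>. slog \<sigma> (measure (mu n \<pi> x \<sigma>) F))"
  show "?U \<le> - (INF y\<in>F. ereal (Gam n \<pi> y x))"
  \<comment> \<open>Testing against every real \<open>z\<close> above the right-hand side yields a
    real lower bound \<open>- z\<close> for \<open>Gam\<close> on \<open>F\<close>, also when
    \<open>F\<close> is empty and the right-hand side is minus infinity.\<close>
  proof (rule ereal_le_real)
    fix z assume "- (INF y\<in>F. ereal (Gam n \<pi> y x)) \<le> ereal z"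
    then have "ereal (- z) \<le> (INF y\<in>F. ereal (Gam n \<pi> y x))"
      using ereal_uminus_le_reorder[of "INF y\<in>F. ereal (Gam n \<pi> y x)" "ereal z"] by simp
    then have "- z \<le> Gam n \<pi> y x" if "y \<in> F" for y
      using that by (auto simp: le_INF_iff)
    then have "?U \<le> ereal (- (- z))"
      using assms x by (intro ldp_upper) auto
    then show "?U \<le> ereal z"
      by simp
  qed
next
  fix x G assume x: "x \<in> open_simplex n" and G: "openin (top_of_set (open_simplex n)) G"
  let ?L = "Liminf (at_right 0) (\<lambda>\<sigma>. slog \<sigma> (measure (mu n \<pi> x \<sigma>) G))"
  \<comment> \<open>Negation turns the pointwise lower bounds into the statement that
    \<open>- ?L\<close> lies below every value of \<open>Gam\<close> on \<open>G\<close>, hence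
    below the infimum.\<close>
  have "- ?L \<le> ereal (Gam n \<pi> y x)" if "y \<in> G" for y
    using ldp_lower[OF assms x G that] by (simp add: ereal_uminus_le_reorder)
  then have "- ?L \<le> (INF y\<in>G. ereal (Gam n \<pi> y x))"
    by (intro INF_greatest)
  then show "- (INF y\<in>G. ereal (Gam n \<pi> y x)) \<le> ?L"
    by (simp add: ereal_uminus_le_reorder)
qed

end
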